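(* Let $\Omega\subset\mathbb{C}^n$ be a bounded domain with $C^2$ boundary, let $\alpha<1$ be real and let $f\in A^2_\alpha(\Omega)$. Then for almost all $\zeta\in\partial\Omega$ (with respect to surface measure on $\partial\Omega$), $$|f(z)|=o\left(\delta_\zeta(z)^{-\frac{1-\alpha}{2}}\right)\quad\text{uniformly, as } z \text{ approaches } \zeta \text{ admissibly};$$ that is, for each $t>0$, $\delta_\zeta(z)^{\frac{1-\alpha}{2}}|f(z)|\to 0$ as $z\to\zeta$ with $z\in\mathcal{A}_t(\zeta)$.
   Context: $\delta_\Omega(z)$ is the Euclidean distance from $z\in\Omega$ to $\partial\Omega$ and $dV$ is Lebesgue measure. $A^2_\alpha(\Omega)$ is the Hilbert space of holomorphic functions $f$ on $\Omega$ with $\int_\Omega|f|^2\delta_\Omega^{-\alpha}\,dV<\infty$. For $\zeta\in\partial\Omega$, $\nu_\zeta$ is the unit outward normal to $\partial\Omega$ at $\zeta$, $T_\zeta$ is the (real, affine) tangent hyperplane to $\partial\Omega$ at $\zeta$, and $\delta_\zeta(z)=\min\{\delta_\Omega(z),d(z,T_\zeta)\}$, where $d(z,T_\zeta)$ is the Euclidean distance from $z$ to $T_\zeta$. For $a,b\in\mathbb{C}^n$, $a\cdot\bar b=\sum_j a_j\bar b_j$. For $t>0$ the admissible approach region with vertex $\zeta$ is $$\mathcal{A}_t(\zeta)=\left\{z\in\Omega:\ |(z-\zeta)\cdot\bar\nu_\zeta|<(1+t)\delta_\zeta(z),\ |z-\zeta|^2<t\,\delta_\zeta(z)\right\}.$$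 *)

theory Defs
  imports "HOL-Analysis.Analysis"
begin

section \<open>Domains with twice continuously differentiable boundary\<close>

definition C2_on :: "'a::euclidean_space set \<Rightarrow> ('a \<Rightarrow> real) \<Rightarrow> bool" where
  "C2_on U r \<longleftrightarrow> (\<exists>(g :: 'a \<Rightarrow> 'a) (H :: 'a \<Rightarrow> 'a \<Rightarrow>\<^sub>L 'a).
     (\<forall>x\<in>U. GDERIV r x :> g x) \<and>
     (\<forall>x\<in>U. (g has_derivative blinfun_apply (H x)) (at x)) \<and>
     continuous_on U H)"

definition local_C2_defining_function ::
  "'a::euclidean_space set \<Rightarrow> 'a \<Rightarrow> 'a set \<Rightarrow> ('a \<Rightarrow> real) \<Rightarrow> bool" where
  "local_C2_defining_function \<Omega> \<zeta> U r \<longleftrightarrow>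
     open U \<and> \<zeta> \<in> U \<and> C2_on U r \<and> \<Omega> \<inter> U = {x\<in>U. r x < 0} \<and> (\<forall>x\<in>U. \<not> GDERIV r x :> 0)"

definition C2_boundary :: "'a::euclidean_space set \<Rightarrow> bool" where
  "C2_boundary \<Omega> \<longleftrightarrow> (\<forall>\<zeta>\<in>frontier \<Omega>. \<exists>U r. local_C2_defining_function \<Omega> \<zeta> U r)"

definition is_unit_outward_normal :: "'a::euclidean_space set \<Rightarrow> 'a \<Rightarrow> 'a \<Rightarrow> bool" where
  "is_unit_outward_normal \<Omega> \<zeta> \<nu> \<longleftrightarrow>
     (\<exists>U r g. local_C2_defining_function \<Omega> \<zeta> U r \<and> GDERIV r \<zeta> :> g \<and> \<nu> = g /\<^sub>R norm g)"

definition unit_outward_normal :: "'a::euclidean_space set \<Rightarrow> 'a \<Rightarrow> 'a" where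
  "unit_outward_normal \<Omega> \<zeta> = (THE \<nu>. is_unit_outward_normal \<Omega> \<zeta> \<nu>)"

lemma GDERIV_along_line:
  assumes "GDERIV r x :> g"
  shows "((\<lambda>t. r (x + t *\<^sub>R v)) has_real_derivative (v \<bullet> g)) (at 0)"
proof -
  have "((\<lambda>t. x + t *\<^sub>R v) has_derivative (\<lambda>t. t *\<^sub>R v)) (at 0)"
    by (auto intro!: derivative_eq_intros)
  moreover have "(r has_derivative (\<lambda>h. h \<bullet> g)) (at (x + 0 *\<^sub>R v))"
    using assms by (simp add: gderiv_def)
  ultimately have "((\<lambda>t. r (x + t *\<^sub>R v)) has_derivative (\<lambda>t. (t *\<^sub>R v) \<bullet> g)) (at 0)"
    by (rule has_derivative_compose)
  then show ?thesis
    by (simp add: has_field_derivative_def mult_commute_abs)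
qed

lemma local_C2_defining_function_at_frontier:
  assumes "local_C2_defining_function \<Omega> \<zeta> U r" "open \<Omega>" "\<zeta> \<in> frontier \<Omega>"
  shows "r \<zeta> = 0"
proof -
  have U: "open U" "\<zeta> \<in> U" and sub: "\<Omega> \<inter> U = {x\<in>U. r x < 0}" and "C2_on U r"
    using assms(1) by (auto simp: local_C2_defining_function_def)
  then obtain g where "GDERIV r \<zeta> :> g" by (auto simp: C2_on_def)
  then have "continuous (at \<zeta>) r" by (simp add: gderiv_def has_derivative_continuous)
  have "\<zeta> \<notin> \<Omega>" "\<zeta> \<in> closure \<Omega>"
    using assms(2,3) by (auto simp: frontier_def interior_open)
  then have "\<not> r \<zeta> < 0" using U sub by blast
  moreover have "\<not> r \<zeta> > 0"
  proof
    assume "r \<zeta> > 0"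
    then have "eventually (\<lambda>x. r x > 0) (nhds \<zeta>)"
      using \<open>continuous (at \<zeta>) r\<close> unfolding isCont_def tendsto_at_iff_tendsto_nhds
      by (rule order_tendstoD(1)[rotated])
    then have "eventually (\<lambda>x. r x > 0 \<and> x \<in> U) (nhds \<zeta>)"
      using U by (intro eventually_conj) (auto simp: eventually_nhds)
    then obtain V where V: "open V" "\<zeta> \<in> V" "\<And>x. x \<in> V \<Longrightarrow> r x > 0 \<and> x \<in> U"
      by (auto simp: eventually_nhds)
    then have "V \<inter> \<Omega> = {}" using sub by force
    then show False using V \<open>\<zeta> \<in> closure \<Omega>\<close> open_Int_closure_eq_empty by blast
  qed
  ultimately show ?thesis by simp
qed

lemma is_unit_outward_normal_unique:
  assumes \<Omega>: "open \<Omega>" "\<zeta> \<in> frontier \<Omega>"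
    and 1: "is_unit_outward_normal \<Omega> \<zeta> \<nu>" and 2: "is_unit_outward_normal \<Omega> \<zeta> \<mu>"
  shows "\<nu> = \<mu>"
proof (rule ccontr)
  assume ne: "\<nu> \<noteq> \<mu>"
  obtain U r g where d: "local_C2_defining_function \<Omega> \<zeta> U r" and g: "GDERIV r \<zeta> :> g"
    and \<nu>: "\<nu> = g /\<^sub>R norm g"
    using 1 by (auto simp: is_unit_outward_normal_def)
  obtain V s h where e: "local_C2_defining_function \<Omega> \<zeta> V s" and h: "GDERIV s \<zeta> :> h"
    and \<mu>: "\<mu> = h /\<^sub>R norm h"
    using 2 by (auto simp: is_unit_outward_normal_def)
  have [simp]: "g \<noteq> 0" "h \<noteq> 0"
    using d e g h by (auto simp: local_C2_defining_function_def)
  have n: "norm \<nu> = 1" "norm \<mu> = 1" by (simp_all add: \<nu> \<mu>)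
  have r0: "r \<zeta> = 0" "s \<zeta> = 0"
    using local_C2_defining_function_at_frontier d e \<Omega> by blast+
  define v where "v = \<mu> - \<nu>"
  have "\<nu> \<bullet> \<mu> < 1"
  proof -
    have "0 < (\<nu> - \<mu>) \<bullet> (\<nu> - \<mu>)" using ne by simp
    also have "\<dots> = \<nu> \<bullet> \<nu> + \<mu> \<bullet> \<mu> - 2 * (\<nu> \<bullet> \<mu>)" by (simp add: inner_diff inner_commute)
    also have "\<dots> = 2 - 2 * (\<nu> \<bullet> \<mu>)" using n by (simp add: dot_square_norm)
    finally show ?thesis by simp
  qed
  then have "v \<bullet> \<nu> < 0" "v \<bullet> \<mu> > 0"
    using n by (simp_all add: v_def inner_diff inner_commute dot_square_norm)
  then have vg: "v \<bullet> g < 0" "v \<bullet> h > 0"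
    by (simp_all add: \<nu> \<mu> zero_less_mult_iff mult_less_0_iff)
  obtain \<delta> where \<delta>: "\<delta> > 0" "\<And>t. 0 < t \<Longrightarrow> t < \<delta> \<Longrightarrow> r (\<zeta> + t *\<^sub>R v) < 0"
    using DERIV_neg_dec_right[OF GDERIV_along_line[OF g] vg(1)] r0 by auto
  obtain \<epsilon> where \<epsilon>: "\<epsilon> > 0" "\<And>t. 0 < t \<Longrightarrow> t < \<epsilon> \<Longrightarrow> s (\<zeta> + t *\<^sub>R v) > 0"
    using DERIV_pos_inc_right[OF GDERIV_along_line[OF h] vg(2)] r0 by auto
  have "open (U \<inter> V)" "\<zeta> \<in> U \<inter> V"
    using d e by (auto simp: local_C2_defining_function_def)
  moreover have "((\<lambda>t. \<zeta> + t *\<^sub>R v) \<longlongrightarrow> \<zeta> + 0 *\<^sub>R v) (at_right 0)"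
    by (intro tendsto_intros)
  ultimately have "eventually (\<lambda>t. \<zeta> + t *\<^sub>R v \<in> U \<inter> V) (at_right 0)"
    using topological_tendstoD by fastforce
  moreover have "eventually (\<lambda>t. 0 < t \<and> t < \<delta> \<and> t < \<epsilon>) (at_right (0::real))"
    using \<delta>(1) \<epsilon>(1) unfolding eventually_at_right_field
    by (intro exI[of _ "min \<delta> \<epsilon>"]) auto
  ultimately have "eventually (\<lambda>t. False) (at_right (0::real))"
  proof eventually_elim
    case (elim t)
    then have "r (\<zeta> + t *\<^sub>R v) < 0" "s (\<zeta> + t *\<^sub>R v) > 0" using \<delta> \<epsilon> by auto
    moreover have "\<Omega> \<inter> U = {x\<in>U. r x < 0}" "\<Omega> \<inter> V = {x\<in>V. s x < 0}"
      using d e by (auto simp: local_C2_defining_function_def)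
    ultimately show False using elim by force
  qed
  then show False by simp
qed

lemma is_unit_outward_normal_unit_outward_normal:
  assumes "open \<Omega>" "C2_boundary \<Omega>" "\<zeta> \<in> frontier \<Omega>"
  shows "is_unit_outward_normal \<Omega> \<zeta> (unit_outward_normal \<Omega> \<zeta>)"
proof -
  obtain U r where d: "local_C2_defining_function \<Omega> \<zeta> U r"
    using assms by (auto simp: C2_boundary_def)
  then obtain g where "GDERIV r \<zeta> :> g"
    by (auto simp: local_C2_defining_function_def C2_on_def)
  with d have "is_unit_outward_normal \<Omega> \<zeta> (g /\<^sub>R norm g)"
    unfolding is_unit_outward_normal_def by blast
  then show ?thesis
    unfolding unit_outward_normal_def
    using is_unit_outward_normal_unique assms by (blast intro: theI2)
qed

definition tangent_hyperplane :: "'a::euclidean_space set \<Rightarrow> 'a \<Rightarrow> 'a set" where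
  "tangent_hyperplane \<Omega> \<zeta> = {z. (z - \<zeta>) \<bullet> unit_outward_normal \<Omega> \<zeta> = 0}"

section \<open>Surface measure\<close>

text \<open>
  The Hausdorff outer measure, with the factor that makes the measure of dimension \<open>d\<close>
  agree with Lebesgue measure on \<open>d\<close>-dimensional Euclidean space.  Covers consist of bounded
  sets, since \<^const>\<open>diameter\<close> is unspecified on unbounded ones; the empty set is
  given the weight 0 also for \<open>d = 0\<close>.
\<close>

definition hausdorff_premeasure :: "nat \<Rightarrow> real \<Rightarrow> 'a::metric_space set \<Rightarrow> ennreal" where
  "hausdorff_premeasure d \<delta> E =
     (INF C \<in> {C :: nat \<Rightarrow> 'a set. E \<subseteq> (\<Union>i. C i) \<and> (\<forall>i. bounded (C i) \<and> diameter (C i) \<le> \<delta>)}.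
        \<Sum>i. if C i = {} then 0 else ennreal (unit_ball_vol (real d) * (diameter (C i) / 2) ^ d))"

definition hausdorff_outer_measure :: "nat \<Rightarrow> 'a::metric_space set \<Rightarrow> ennreal" where
  "hausdorff_outer_measure d E = (SUP \<delta>\<in>{0<..}. hausdorff_premeasure d \<delta> E)"

text \<open>
  The surface measure is the Hausdorff measure of codimension 1 on the boundary, on the
  \<open>\<sigma>\<close>-algebra of the subsets of the boundary that are measurable in the sense of Caratheodory.
\<close>

definition surface_measure :: "'a::euclidean_space set \<Rightarrow> 'a measure" where
  "surface_measure \<Omega> =
     measure_of (frontier \<Omega>)
       (lambda_system (frontier \<Omega>) (Pow (frontier \<Omega>)) (hausdorff_outer_measure (DIM('a) - 1)))
       (hausdorff_outer_measure (DIM('a) - 1))"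

lemma hausdorff_premeasure_empty: "0 \<le> \<delta> \<Longrightarrow> hausdorff_premeasure d \<delta> {} = 0"
  unfolding hausdorff_premeasure_def
  by (rule antisym[OF INF_lower2[of "\<lambda>_. {}"]]) auto

lemma hausdorff_premeasure_mono:
  "E \<subseteq> F \<Longrightarrow> hausdorff_premeasure d \<delta> E \<le> hausdorff_premeasure d \<delta> F"
  unfolding hausdorff_premeasure_def by (rule INF_superset_mono) auto

lemma hausdorff_premeasure_UN:
  "hausdorff_premeasure d \<delta> (\<Union>n. E n) \<le> (\<Sum>n::nat. hausdorff_premeasure d \<delta> (E n))"
    (is "?l \<le> ?r")
proof (rule ennreal_le_epsilon)
  define w :: "'a set \<Rightarrow> ennreal" where
    "w = (\<lambda>S. if S = {} then 0 else ennreal (unit_ball_vol (real d) * (diameter S / 2) ^ d))"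
  define K where "K = (\<lambda>E (C :: nat \<Rightarrow> 'a set). E \<subseteq> (\<Union>i. C i) \<and> (\<forall>i. bounded (C i) \<and> diameter (C i) \<le> \<delta>))"
  have H: "hausdorff_premeasure d \<delta> E = (INF C \<in> Collect (K E). \<Sum>i. w (C i))" for E
    by (simp add: hausdorff_premeasure_def w_def K_def)
  fix e :: real assume fin: "?r < top" and e: "0 < e"
  have "\<exists>C. K (E n) C \<and> (\<Sum>i. w (C i)) \<le> hausdorff_premeasure d \<delta> (E n) + ennreal (e * (1/2) ^ Suc n)" for n
  proof -
    have "hausdorff_premeasure d \<delta> (E n) < top"
      using fin ennreal_suminf_lessD by blast
    then have "hausdorff_premeasure d \<delta> (E n) < hausdorff_premeasure d \<delta> (E n) + ennreal (e * (1/2) ^ Suc n)"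
      using e ennreal_add_left_cancel_less[of "hausdorff_premeasure d \<delta> (E n)" 0] by auto
    then show ?thesis
      unfolding H[of "E n"] by (subst (asm) INF_less_iff) (auto intro: less_imp_le)
  qed
  then obtain C where C: "\<And>n. K (E n) (C n)"
    "\<And>n. (\<Sum>i. w (C n i)) \<le> hausdorff_premeasure d \<delta> (E n) + ennreal (e * (1/2) ^ Suc n)"
    by metis
  define D where "D = (\<lambda>i. case prod_decode i of (m, n) \<Rightarrow> C m n)"
  have "K (\<Union>n. E n) D"
    unfolding K_def
  proof (intro conjI allI)
    show "(\<Union>n. E n) \<subseteq> (\<Union>i. D i)"
    proof
      fix x assume "x \<in> (\<Union>n. E n)"
      then obtain m n where "x \<in> C m n" using C(1) unfolding K_def by blast
      then have "x \<in> D (prod_encode (m, n))" by (simp add: D_def)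
      then show "x \<in> (\<Union>i. D i)" by blast
    qed
    show "bounded (D i)" "diameter (D i) \<le> \<delta>" for i
      using C(1) by (auto simp: K_def D_def split: prod.split)
  qed
  then have "?l \<le> (\<Sum>i. w (D i))" unfolding H by (intro INF_lower) auto
  also have "\<dots> = (\<Sum>i. (\<lambda>(m, n). w (C m n)) (prod_decode i))"
    by (simp add: D_def case_prod_beta)
  also have "\<dots> = (\<Sum>m. \<Sum>n. w (C m n))"
    by (rule suminf_ennreal_2dimen) simp
  also have "\<dots> \<le> (\<Sum>n. hausdorff_premeasure d \<delta> (E n) + ennreal (e * (1/2) ^ Suc n))"
    by (intro suminf_le C(2)) auto
  also have "\<dots> = ?r + (\<Sum>n. ennreal (e * (1/2) ^ Suc n))"
    by (intro suminf_add[symmetric]) auto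
  also have "(\<Sum>n. ennreal (e * (1/2) ^ Suc n)) = ennreal e"
    using sums_mult[OF power_half_series, of e] e by (intro suminf_ennreal_eq) auto
  finally show "?l \<le> ?r + ennreal e" .
qed

lemma outer_measure_space_hausdorff_outer_measure:
  "outer_measure_space (Pow S) (hausdorff_outer_measure d)"
  unfolding outer_measure_space_def
proof (intro conjI)
  show "positive (Pow S) (hausdorff_outer_measure d)"
    by (auto simp: positive_def hausdorff_outer_measure_def hausdorff_premeasure_empty
        cong: SUP_cong_simp)
  show "increasing (Pow S) (hausdorff_outer_measure d)"
    by (auto simp: increasing_def hausdorff_outer_measure_def
        intro!: SUP_mono' hausdorff_premeasure_mono)
  show "countably_subadditive (Pow S) (hausdorff_outer_measure d)"
    unfolding countably_subadditive_def hausdorff_outer_measure_def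
  proof safe
    fix A :: "nat \<Rightarrow> _"
    show "(SUP \<delta>\<in>{0<..}. hausdorff_premeasure d \<delta> (\<Union>i. A i))
        \<le> (\<Sum>i. SUP \<delta>\<in>{0<..}. hausdorff_premeasure d \<delta> (A i))"
      by (intro SUP_least order_trans[OF hausdorff_premeasure_UN] suminf_le SUP_upper) auto
  qed
qed

lemma measure_space_surface_measure:
  fixes \<Omega> :: "'a::euclidean_space set"
  shows "measure_space (frontier \<Omega>)
    (lambda_system (frontier \<Omega>) (Pow (frontier \<Omega>)) (hausdorff_outer_measure (DIM('a) - 1)))
    (hausdorff_outer_measure (DIM('a) - 1))"
  by (rule sigma_algebra.caratheodory_lemma
      [OF sigma_algebra_Pow outer_measure_space_hausdorff_outer_measure])

lemma space_surface_measure [simp]: "space (surface_measure \<Omega>) = frontier \<Omega>"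
  unfolding surface_measure_def
  by (rule space_measure_of) (auto simp: lambda_system_def)

lemma sets_surface_measure:
  fixes \<Omega> :: "'a::euclidean_space set"
  shows "sets (surface_measure \<Omega>) =
    lambda_system (frontier \<Omega>) (Pow (frontier \<Omega>)) (hausdorff_outer_measure (DIM('a) - 1))"
  using measure_space_surface_measure[of \<Omega>] unfolding surface_measure_def measure_space_def
  by (metis sigma_algebra.sets_measure_of_eq)

lemma emeasure_surface_measure:
  fixes \<Omega> :: "'a::euclidean_space set"
  assumes "E \<in> sets (surface_measure \<Omega>)"
  shows "emeasure (surface_measure \<Omega>) E = hausdorff_outer_measure (DIM('a) - 1) E"
  using assms measure_space_surface_measure[of \<Omega>] sets_surface_measure[of \<Omega>]
  unfolding surface_measure_def measure_space_def
  by (intro emeasure_measure_of_sigma) auto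

lemma AE_surface_measure_iff:
  fixes \<Omega> :: "'a::euclidean_space set"
  shows "(AE \<zeta> in surface_measure \<Omega>. P \<zeta>) \<longleftrightarrow>
    hausdorff_outer_measure (DIM('a) - 1) {\<zeta>\<in>frontier \<Omega>. \<not> P \<zeta>} = 0" (is "?A \<longleftrightarrow> ?Z")
proof -
  let ?h = "hausdorff_outer_measure (DIM('a) - 1) :: 'a set \<Rightarrow> ennreal"
  let ?N = "{\<zeta>\<in>frontier \<Omega>. \<not> P \<zeta>}"
  have mono: "?h A \<le> ?h B" if "A \<subseteq> B" for A B :: "'a set"
    using that outer_measure_space_hausdorff_outer_measure[of UNIV "DIM('a) - 1"]
    by (auto simp: outer_measure_space_def increasing_def)
  show ?thesis
  proof
    assume "AE \<zeta> in surface_measure \<Omega>. P \<zeta>"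
    then obtain N where "?N \<subseteq> N" "N \<in> sets (surface_measure \<Omega>)" "emeasure (surface_measure \<Omega>) N = 0"
      by (auto elim!: AE_E)
    then show "?h ?N = 0"
      using mono[of ?N N] by (simp add: emeasure_surface_measure)
  next
    assume 0: "?h ?N = 0"
    have "?N \<in> sets (surface_measure \<Omega>)"
      unfolding sets_surface_measure lambda_system_def
    proof safe
      fix x assume x: "x \<subseteq> frontier \<Omega>"
      have "?h (?N \<inter> x) = 0" using mono[of "?N \<inter> x" ?N] 0 by simp
      moreover have "?h ((frontier \<Omega> - ?N) \<inter> x) \<le> ?h x" by (rule mono) auto
      moreover have "?h x \<le> ?h (?N \<inter> x) + ?h ((frontier \<Omega> - ?N) \<inter> x)"
      proof -
        have "subadditive (Pow UNIV) ?h"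
          using outer_measure_space_hausdorff_outer_measure[of "UNIV :: 'a set"]
          by (intro ring_of_sets.countably_subadditive_subadditive[of UNIV])
             (auto simp: outer_measure_space_def intro: algebra.axioms algebra_Pow[of UNIV, simplified])
        then have "?h ((?N \<inter> x) \<union> ((frontier \<Omega> - ?N) \<inter> x)) \<le> ?h (?N \<inter> x) + ?h ((frontier \<Omega> - ?N) \<inter> x)"
          by (rule subadditiveD) auto
        moreover have "(?N \<inter> x) \<union> ((frontier \<Omega> - ?N) \<inter> x) = x" using x by auto
        ultimately show ?thesis by simp
      qed
      ultimately show "?h (?N \<inter> x) + ?h ((frontier \<Omega> - ?N) \<inter> x) = ?h x" by simp
    qed
    with 0 show "AE \<zeta> in surface_measure \<Omega>. P \<zeta>"
      by (intro AE_I[of _ _ ?N]) (auto simp: emeasure_surface_measure)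
  qed
qed

section \<open>Weighted Bergman spaces and admissible approach regions\<close>

definition holomorphic_on_Cn :: "(complex ^ 'n \<Rightarrow> complex) \<Rightarrow> (complex ^ 'n) set \<Rightarrow> bool" where
  "holomorphic_on_Cn f \<Omega> \<longleftrightarrow>
     (\<forall>z\<in>\<Omega>. \<exists>L. (f has_derivative L) (at z) \<and> (\<forall>c v. L (c *s v) = c * L v))"

definition boundary_dist :: "'a::euclidean_space set \<Rightarrow> 'a \<Rightarrow> real" where
  "boundary_dist \<Omega> z = infdist z (frontier \<Omega>)"

definition weighted_bergman_space :: "real \<Rightarrow> (complex ^ 'n) set \<Rightarrow> (complex ^ 'n \<Rightarrow> complex) set" where
  "weighted_bergman_space \<alpha> \<Omega> =
     {f. holomorphic_on_Cn f \<Omega> \<and>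
         set_integrable lborel \<Omega> (\<lambda>z. (cmod (f z))\<^sup>2 * boundary_dist \<Omega> z powr (- \<alpha>))}"

definition tangential_dist :: "'a::euclidean_space set \<Rightarrow> 'a \<Rightarrow> 'a \<Rightarrow> real" where
  "tangential_dist \<Omega> \<zeta> z = min (boundary_dist \<Omega> z) (infdist z (tangent_hyperplane \<Omega> \<zeta>))"

definition hermitian_dot :: "complex ^ 'n \<Rightarrow> complex ^ 'n \<Rightarrow> complex" where
  "hermitian_dot a b = (\<Sum>j\<in>UNIV. a $ j * cnj (b $ j))"

definition admissible_region ::
  "(complex ^ 'n) set \<Rightarrow> complex ^ 'n \<Rightarrow> real \<Rightarrow> (complex ^ 'n) set" where
  "admissible_region \<Omega> \<zeta> t =
     {z\<in>\<Omega>. cmod (hermitian_dot (z - \<zeta>) (unit_outward_normal \<Omega> \<zeta>)) < (1 + t) * tangential_dist \<Omega> \<zeta> z \<and>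
           (norm (z - \<zeta>))\<^sup>2 < t * tangential_dist \<Omega> \<zeta> z}"

text \<open>
  \<^const>\<open>unit_outward_normal\<close> and \<^const>\<open>tangent_hyperplane\<close> refer to the real inner product,
  which is the real part of the Hermitian one.
\<close>

lemma Re_hermitian_dot: "Re (hermitian_dot a b) = a \<bullet> b"
  by (simp add: hermitian_dot_def inner_vec_def inner_complex_def)

end

theory Submission
  imports Defs "HOL-Complex_Analysis.Cauchy_Integral_Formula"
begin

text \<open>
  Let \<open>\<mu>\<close> be the finite measure \<open>\<bar>f\<bar>\<^sup>2 \<delta>\<^sub>\<Omega>\<^sup>-\<^sup>\<alpha> dV\<close> and let \<open>B(\<zeta>, s)\<close> be the set of \<open>w\<close> with
  \<open>\<bar>w - \<zeta>\<bar>\<^sup>2 < s\<close> and \<open>\<bar>(w - \<zeta>) \<cdot> \<nu>\<bar> < s\<close>, where \<open>\<nu>\<close> is the normal at \<open>\<zeta>\<close>.  For \<open>z\<close> in an admissible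
  region and \<open>\<tau> = \<delta>\<^sub>\<zeta>(z)\<close>, the translate to \<open>z\<close> of \<open>B(\<zeta>, c \<tau>)\<close> for a small \<open>c\<close> has volume at least a
  multiple of \<open>\<tau>\<^sup>n\<^sup>+\<^sup>1\<close>, stays inside \<open>\<Omega> \<inter> B(\<zeta>, K \<tau>)\<close>, and has boundary distance comparable to \<open>\<tau>\<close>;
  subharmonicity of \<open>\<bar>f\<bar>\<^sup>2\<close> therefore gives \<open>\<tau>\<^sup>1\<^sup>-\<^sup>\<alpha> \<bar>f(z)\<bar>\<^sup>2 \<le> C \<mu>(B(\<zeta>, K \<tau>)) / \<tau>\<^sup>n\<close>.  The sets
  \<open>B(\<zeta>, s) \<inter> \<partial>\<Omega>\<close> have surface measure at most a multiple of \<open>s\<^sup>n\<close> and satisfy an engulfing property,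
  so a Vitali covering argument bounds the measure of the set of \<open>\<zeta>\<close> where
  \<open>limsup \<mu>(B(\<zeta>, s)) / s\<^sup>n > \<lambda>\<close> by \<open>C / \<lambda>\<close> times the \<open>\<mu>\<close>-mass of any neighbourhood of \<open>\<partial>\<Omega>\<close>, which
  can be made arbitrarily small.
\<close>

section \<open>A mean value inequality over balanced sets\<close>

lemma nn_integral_lborel_translate:
  fixes a :: "'a::euclidean_space"
  assumes [measurable]: "F \<in> borel_measurable borel"
  shows "(\<integral>\<^sup>+x. F (a + x) \<partial>lborel) = (\<integral>\<^sup>+x. F x \<partial>lborel)"
  by (subst lborel_distr_plus[of a, symmetric]) (simp add: nn_integral_distr)

text \<open>Two translation invariant measures that agree on the unit ball agree everywhere, because
  \<open>\<integral>\<integral> 1\<^sub>C(x) 1\<^sub>B(x + y) d\<mu>(y) dx\<close> is both \<open>|C| \<mu>(B)\<close> and \<open>|B| \<mu>(- C)\<close>.\<close>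

lemma distr_lborel_isometry:
  fixes T :: "'a::euclidean_space \<Rightarrow> 'a"
  assumes T: "linear T" "surj T" "\<And>x. norm (T x) = norm x"
  shows "distr lborel borel T = lborel"
proof (rule measure_eqI)
  let ?\<mu> = "distr lborel borel T"
  have [measurable]: "T \<in> borel_measurable borel"
    using T(1) linear_continuous_on linear_conv_bounded_linear
    by (intro borel_measurable_continuous_onI) blast
  have trans: "(\<integral>\<^sup>+y. F (a + y) \<partial>?\<mu>) = (\<integral>\<^sup>+y. F y \<partial>?\<mu>)"
    if [measurable]: "F \<in> borel_measurable borel" for F and a :: 'a
  proof -
    obtain b where b: "a = T b" using T(2) by blast
    have "(\<integral>\<^sup>+y. F (a + y) \<partial>?\<mu>) = (\<integral>\<^sup>+y. F (T (b + y)) \<partial>lborel)"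
      by (simp add: nn_integral_distr b linear_add[OF T(1)])
    also have "\<dots> = (\<integral>\<^sup>+y. F (T y) \<partial>lborel)"
      by (rule nn_integral_lborel_translate) simp
    finally show ?thesis by (simp add: nn_integral_distr)
  qed
  define C where "C = ball (0::'a) 1"
  have [measurable]: "C \<in> sets borel" by (simp add: C_def)
  have ball: "T -` C = C" using T(3) by (auto simp: C_def)
  \<comment> \<open>Sigma-finiteness is what Fubini asks for. The balls about 0 exhaust the space
    and equal their own preimages under \<open>T\<close>, so their mass is finite.\<close>
  interpret \<mu>: sigma_finite_measure ?\<mu>
  proof (rule sigma_finite_measure.intro, rule exI[of _ "range (\<lambda>n. ball (0::'a) (real n))"], intro conjI)
    show "\<Union> (range (\<lambda>n. ball (0::'a) (real n))) = space ?\<mu>"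
      by (auto simp: reals_Archimedean2)
    have "T -` ball 0 (real n) = ball 0 (real n)" for n using T(3) by auto
    then show "\<forall>a\<in>range (\<lambda>n. ball (0::'a) (real n)). emeasure ?\<mu> a \<noteq> \<infinity>"
      using emeasure_lborel_ball_finite[of "0::'a"] by (auto simp: emeasure_distr less_top)
  qed auto
  interpret P: pair_sigma_finite lborel ?\<mu> ..
  show "sets ?\<mu> = sets lborel" by simp
  fix B :: "'a set" assume "B \<in> sets ?\<mu>"
  then have [measurable]: "B \<in> sets borel" by simp
  have "emeasure lborel C * emeasure ?\<mu> B
      = (\<integral>\<^sup>+x. indicator C x * (\<integral>\<^sup>+y. indicator B (x + y) \<partial>?\<mu>) \<partial>lborel)"
    by (subst trans, simp, subst nn_integral_multc) (auto intro!: borel_measurable_indicator)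
  also have "\<dots> = (\<integral>\<^sup>+x. \<integral>\<^sup>+y. indicator C x * indicator B (x + y) \<partial>?\<mu> \<partial>lborel)"
    by (subst nn_integral_cmult) auto
  also have "\<dots> = (\<integral>\<^sup>+y. \<integral>\<^sup>+x. indicator C x * indicator B (x + y) \<partial>lborel \<partial>?\<mu>)"
    by (rule P.Fubini'[symmetric]) measurable
  also have "\<dots> = (\<integral>\<^sup>+y. \<integral>\<^sup>+x. indicator C (x - y) * indicator B x \<partial>lborel \<partial>?\<mu>)"
    using nn_integral_lborel_translate[of "\<lambda>x. indicator C x * indicator B (x + y)" "- y" for y, symmetric]
    by simp
  also have "\<dots> = (\<integral>\<^sup>+x. \<integral>\<^sup>+y. indicator C (x - y) * indicator B x \<partial>?\<mu> \<partial>lborel)"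
    by (rule P.Fubini') measurable
  also have "\<dots> = (\<integral>\<^sup>+x. indicator B x * (\<integral>\<^sup>+y. indicator C (- x + y) \<partial>?\<mu>) \<partial>lborel)"
  proof (rule nn_integral_cong)
    fix x
    have "indicator C (x - y) = (indicator C (- x + y) :: ennreal)" for y
      by (simp add: C_def indicator_def dist_norm norm_minus_commute)
    then show "(\<integral>\<^sup>+y. indicator C (x - y) * indicator B x \<partial>?\<mu>)
        = indicator B x * (\<integral>\<^sup>+y. indicator C (- x + y) \<partial>?\<mu>)"
      by (subst nn_integral_cmult[symmetric]) (auto simp: mult.commute)
  qed
  also have "\<dots> = emeasure lborel B * emeasure ?\<mu> C"
    by (subst trans, simp, subst nn_integral_multc) (auto intro!: borel_measurable_indicator)
  \<comment> \<open>The unit ball is \<open>T\<close>-invariant, which fixes the constant of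
    proportionality. It cancels below because the ball has positive finite volume.\<close>
  also have "emeasure ?\<mu> C = emeasure lborel C" by (simp add: emeasure_distr ball)
  finally have "emeasure lborel C * emeasure ?\<mu> B = emeasure lborel C * emeasure lborel B"
    by (simp add: mult.commute)
  moreover have "emeasure lborel C \<noteq> 0"
    using unit_ball_vol_pos[of "real DIM('a)"] by (simp add: C_def emeasure_ball del: unit_ball_vol_pos)
  moreover have "emeasure lborel C \<noteq> \<infinity>"
    using emeasure_lborel_ball_finite[of "0::'a" 1] by (simp add: C_def less_top)
  ultimately show "emeasure ?\<mu> B = emeasure lborel B"
    by (simp add: ennreal_mult_cancel_left)
qed

text \<open>Cauchy's formula is applied to the holomorphic function r^2, so r(0)^2 is the mean of
  r^2 over the unit circle; then the modulus moves under the integral. The nonnegative integral over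
  [0,1] is the form to which Fubini is applied later.\<close>

lemma cmod_circle_mean:
  assumes r: "r holomorphic_on S" "open S" "cball 0 1 \<subseteq> S"
  shows "ennreal ((cmod (r 0))\<^sup>2) \<le> (\<integral>\<^sup>+t\<in>{0..1}. ennreal ((cmod (r (cis (2 * pi * t))))\<^sup>2) \<partial>lborel)"
proof -
  have h2: "(\<lambda>w. (r w)\<^sup>2) holomorphic_on cball 0 1"
    using r by (intro holomorphic_intros) (auto intro: holomorphic_on_subset)
  have "((\<lambda>u. (r u)\<^sup>2 / (u - 0)) has_contour_integral (2 * of_real pi * \<i> * (r 0)\<^sup>2)) (circlepath 0 1)"
    by (rule Cauchy_integral_circlepath_simple[OF h2]) auto
  then have "((\<lambda>t. (r (cis (2 * pi * t)))\<^sup>2 / cis (2 * pi * t) * (2 * pi * \<i> * cis (2 * pi * t)))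
      has_integral (2 * of_real pi * \<i> * (r 0)\<^sup>2)) {0..1}"
    unfolding has_contour_integral_def
  proof (rule has_integral_eq[rotated])
    fix t :: real assume "t \<in> {0..1}"
    then show "(r (circlepath 0 1 t))\<^sup>2 / (circlepath 0 1 t - 0) *
        vector_derivative (circlepath 0 1) (at t within {0..1}) =
        (r (cis (2 * pi * t)))\<^sup>2 / cis (2 * pi * t) * (2 * pi * \<i> * cis (2 * pi * t))"
      by (simp add: vector_derivative_circlepath01) (simp add: circlepath cis_conv_exp mult_ac)
  qed
  moreover define k where "k = 2 * of_real pi * \<i>"
  ultimately have "((\<lambda>t. k * (r (cis (2 * pi * t)))\<^sup>2) has_integral k * (r 0)\<^sup>2) {0..1}"
    by (auto elim!: has_integral_eq[rotated])
  then have "((\<lambda>t. inverse k * (k * (r (cis (2 * pi * t)))\<^sup>2)) has_integral inverse k * (k * (r 0)\<^sup>2)) {0..1}"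
    by (rule has_integral_mult_right)
  moreover have "k \<noteq> 0" by (simp add: k_def)
  then have "inverse k * (k * x) = x" for x by (simp add: field_simps)
  ultimately have I: "((\<lambda>t. (r (cis (2 * pi * t)))\<^sup>2) has_integral (r 0)\<^sup>2) {0..1}"
    by (simp only:)
  have ci: "cis (2 * pi * t) \<in> S" for t using r(3) by auto
  have cont: "continuous_on A (\<lambda>t. r (cis (2 * pi * t)))" for A
    by (rule continuous_on_compose2[OF holomorphic_on_imp_continuous_on[OF r(1)]])
      (auto intro!: continuous_intros ci)
  let ?F = "\<lambda>t. (cmod (r (cis (2 * pi * t))))\<^sup>2"
  have Fint: "?F integrable_on {0..1}"
    by (intro integrable_continuous_interval continuous_intros cont)
  have "(cmod (r 0))\<^sup>2 = norm (integral {0..1} (\<lambda>t. (r (cis (2 * pi * t)))\<^sup>2))"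
    using I by (simp add: integral_unique norm_power)
  also have "\<dots> \<le> integral {0..1} ?F"
    using I Fint by (intro integral_norm_bound_integral) (auto simp: norm_power)
  finally have "ennreal ((cmod (r 0))\<^sup>2) \<le> ennreal (integral {0..1} ?F)" by (simp add: ennreal_leI)
  also have "\<dots> = (\<integral>\<^sup>+t\<in>{0..1}. ennreal (?F t) \<partial>lborel)"
    using Fint by (intro nn_integral_has_integral_lebesgue'[symmetric]) (auto simp: has_integral_iff)
  finally show ?thesis .
qed

section \<open>Complex scalars acting on C^n, slices by complex lines and the averaged
  inequality\<close>

lemma norm_scalar_mult_vec: "norm (c *s (x :: complex ^ 'n)) = cmod c * norm x"
  by (simp add: norm_vec_def L2_set_right_distrib norm_mult)

lemma bounded_linear_scalar_mult_left: "bounded_linear (\<lambda>c. c *s (u :: complex ^ 'n))"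
  unfolding linear_conv_bounded_linear[symmetric]
  by (intro linearI) (auto simp: vec_eq_iff algebra_simps)

lemma linear_scalar_mult_right: "linear (\<lambda>u :: complex ^ 'n. c *s u)"
  by (intro linearI) (auto simp: vec_eq_iff algebra_simps)

lemma continuous_on_scalar_mult_vec [continuous_intros]:
  fixes g :: "'a::topological_space \<Rightarrow> complex ^ 'n"
  assumes "continuous_on S c" "continuous_on S g"
  shows "continuous_on S (\<lambda>x. c x *s g x)"
  unfolding vector_scalar_mult_def by (intro continuous_intros assms)

lemma holomorphic_on_Cn_imp_continuous_on:
  "holomorphic_on_Cn f \<Omega> \<Longrightarrow> continuous_on \<Omega> f"
  unfolding holomorphic_on_Cn_def
  by (intro continuous_at_imp_continuous_on) (auto dest!: has_derivative_continuous)

text \<open>The derivative \<open>L\<close> is complex homogeneous, so the chain rule along the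
  complex line yields h * L u, that is, the complex derivative L u.\<close>

lemma holomorphic_on_Cn_slice:
  assumes f: "holomorphic_on_Cn f \<Omega>"
  shows "(\<lambda>c. f (z + c *s u)) holomorphic_on {c. z + c *s u \<in> \<Omega>}"
proof (rule holomorphic_onI, rule field_differentiable_at_within)
  fix c assume "c \<in> {c. z + c *s u \<in> \<Omega>}"
  then obtain L where L: "(f has_derivative L) (at (z + c *s u))" "\<And>c v. L (c *s v) = c * L v"
    using f unfolding holomorphic_on_Cn_def by blast
  have "((\<lambda>c. z + c *s u) has_derivative (\<lambda>h. h *s u)) (at c)"
    using bounded_linear_imp_has_derivative[OF bounded_linear_scalar_mult_left]
    by (auto intro!: derivative_eq_intros)
  from has_derivative_compose[OF this L(1)]
  have "((\<lambda>c. f (z + c *s u)) has_derivative (\<lambda>h. h * L u)) (at c)"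
    by (simp only: L(2))
  moreover have "(\<lambda>h. h * L u) = (*) (L u)" by (simp add: fun_eq_iff)
  ultimately show "(\<lambda>c. f (z + c *s u)) field_differentiable at c"
    by (auto simp: field_differentiable_def has_field_derivative_def)
qed

text \<open>Average the circle mean value inequality over all directions \<open>u \<in> D\<close>; since \<open>D\<close> and
  Lebesgue measure are invariant under \<open>u \<mapsto> e\<^sup>i\<^sup>\<theta>u\<close>, no coordinates adapted to \<open>D\<close> are needed.\<close>

lemma cmod_square_mean_balanced:
  fixes f :: "complex ^ 'n \<Rightarrow> complex"
  assumes f: "holomorphic_on_Cn f \<Omega>" "open \<Omega>" and D: "open D"
    and bal: "\<And>u c. u \<in> D \<Longrightarrow> cmod c \<le> 1 \<Longrightarrow> c *s u \<in> D"
    and sub: "\<And>u. u \<in> D \<Longrightarrow> z + u \<in> \<Omega>"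
  shows "ennreal ((cmod (f z))\<^sup>2) * emeasure lborel D
    \<le> (\<integral>\<^sup>+u\<in>D. ennreal ((cmod (f (z + u)))\<^sup>2) \<partial>lborel)"
proof -
  define F where "F = (\<lambda>u. ennreal ((cmod (f (z + u)))\<^sup>2) * indicator D u)"
  have [measurable]: "D \<in> sets borel" using D by simp
  have "continuous_on D (\<lambda>u. (cmod (f (z + u)))\<^sup>2)"
    using sub by (intro continuous_intros
        continuous_on_compose2[OF holomorphic_on_Cn_imp_continuous_on[OF f(1)]]) auto
  then have "(\<lambda>u. indicator D u *\<^sub>R (cmod (f (z + u)))\<^sup>2) \<in> borel_measurable borel"
    by (intro borel_measurable_continuous_on_indicator) auto
  moreover have "F = (\<lambda>u. ennreal (indicator D u *\<^sub>R (cmod (f (z + u)))\<^sup>2))"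
    by (auto simp: F_def indicator_def)
  ultimately have [measurable]: "F \<in> borel_measurable borel" by simp
  \<comment> \<open>Multiplication by a unimodular scalar is a linear isometry onto C^n and hence
    preserves Lebesgue measure.\<close>
  have rot: "(\<integral>\<^sup>+u. F (cis s *s u) \<partial>lborel) = (\<integral>\<^sup>+u. F u \<partial>lborel)" for s
  proof -
    have "surj (\<lambda>u :: complex ^ 'n. cis s *s u)"
    proof (rule surjI)
      show "cis s *s (cis (- s) *s u) = u" for u :: "complex ^ 'n"
        by (simp add: vector_smult_assoc cis_mult)
    qed
    then have "distr lborel borel (\<lambda>u :: complex ^ 'n. cis s *s u) = lborel"
      by (intro distr_lborel_isometry linear_scalar_mult_right) (auto simp: norm_scalar_mult_vec)
    moreover have [measurable]: "(\<lambda>u :: complex ^ 'n. cis s *s u) \<in> borel_measurable borel"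
      by (intro borel_measurable_continuous_onI continuous_intros)
    have "(\<integral>\<^sup>+u. F u \<partial>distr lborel borel (\<lambda>u. cis s *s u)) = (\<integral>\<^sup>+u. F (cis s *s u) \<partial>lborel)"
      by (rule nn_integral_distr) simp_all
    ultimately show ?thesis by simp
  qed
  \<comment> \<open>Continuity of the rotation in both variables gives Borel measurability on the
    product space; this identity turns it into measurability for the product sigma-algebra, which
    Fubini uses.\<close>
  have prod_sets: "sets (lborel \<Otimes>\<^sub>M lborel) = sets (borel :: (real \<times> (complex ^ 'n)) measure)"
    unfolding borel_prod[symmetric] by (intro sets_pair_measure_cong) simp_all
  have "(\<lambda>p. cis (2 * pi * fst p) *s (snd p :: complex ^ 'n)) \<in> borel_measurable borel"
    by (intro borel_measurable_continuous_onI continuous_intros)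
  then have [measurable]: "(\<lambda>p. cis (2 * pi * fst p) *s (snd p :: complex ^ 'n)) \<in> (lborel \<Otimes>\<^sub>M lborel) \<rightarrow>\<^sub>M borel"
    by (subst measurable_cong_sets[OF prod_sets refl])
  have "ennreal ((cmod (f z))\<^sup>2) * emeasure lborel D
      = (\<integral>\<^sup>+u. ennreal ((cmod (f z))\<^sup>2) * indicator D u \<partial>lborel)"
    by (simp add: nn_integral_cmult_indicator)
  also have "\<dots> \<le> (\<integral>\<^sup>+u. \<integral>\<^sup>+t. F (cis (2 * pi * t) *s u) * indicator {0..1} t \<partial>lborel \<partial>lborel)"
  proof (rule nn_integral_mono)
    fix u :: "complex ^ 'n"
    show "ennreal ((cmod (f z))\<^sup>2) * indicator D u
        \<le> (\<integral>\<^sup>+t. F (cis (2 * pi * t) *s u) * indicator {0..1::real} t \<partial>lborel)"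
    proof (cases "u \<in> D")
      case True
      have "open ((\<lambda>c. z + c *s u) -` \<Omega>)"
        by (intro open_vimage f continuous_intros)
      then have op: "open {c. z + c *s u \<in> \<Omega>}" by (simp add: vimage_def)
      \<comment> \<open>Since \<open>D\<close> is balanced, the closed unit disc lies in the open
        domain of the slice through \<open>z\<close> in direction \<open>u\<close>.\<close>
      have "ennreal ((cmod (f (z + 0 *s u)))\<^sup>2)
          \<le> (\<integral>\<^sup>+t\<in>{0..1}. ennreal ((cmod (f (z + cis (2 * pi * t) *s u)))\<^sup>2) \<partial>lborel)"
        using bal[OF True] sub
        by (intro cmod_circle_mean[OF holomorphic_on_Cn_slice[OF f(1)] op]) auto
      also have "\<dots> = (\<integral>\<^sup>+t. F (cis (2 * pi * t) *s u) * indicator {0..1::real} t \<partial>lborel)"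
        using bal[OF True] by (simp add: F_def)
      finally show ?thesis
        using True by (simp only: indicator_simps mult_1_right vector_smult_lzero add_0_right)
    next
      case False
      then have "ennreal ((cmod (f z))\<^sup>2) * indicator D u = 0" by simp
      then show ?thesis by (simp only: zero_le)
    qed
  qed
  \<comment> \<open>After the exchange the inner integral has the same value for every
    \<open>t\<close>, by \<open>rot\<close>, and [0,1] has length 1.\<close>
  also have "\<dots> = (\<integral>\<^sup>+t. \<integral>\<^sup>+u. F (cis (2 * pi * t) *s u) * indicator {0..1} t \<partial>lborel \<partial>lborel)"
    by (rule lborel_pair.Fubini') measurable
  also have "\<dots> = (\<integral>\<^sup>+t. (\<integral>\<^sup>+u. F u \<partial>lborel) * indicator {0..1::real} t \<partial>lborel)"
  proof (rule nn_integral_cong)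
    fix t :: real
    have "(\<lambda>u. F (cis (2 * pi * t) *s u)) \<in> borel_measurable lborel"
      by (rule measurable_compose[OF _ \<open>F \<in> borel_measurable borel\<close>])
        (simp, intro borel_measurable_continuous_onI continuous_intros)
    then show "(\<integral>\<^sup>+u. F (cis (2 * pi * t) *s u) * indicator {0..1} t \<partial>lborel)
        = (\<integral>\<^sup>+u. F u \<partial>lborel) * indicator {0..1} t"
      by (simp add: nn_integral_multc rot)
  qed
  also have "\<dots> = (\<integral>\<^sup>+u. F u \<partial>lborel)"
    by (simp add: nn_integral_cmult_indicator)
  finally show ?thesis by (simp add: F_def)
qed

section \<open>Nonisotropic balls\<close>

lemma hermitian_dot_add_left: "hermitian_dot (a + b) c = hermitian_dot a c + hermitian_dot b c"
  by (simp add: hermitian_dot_def algebra_simps sum.distrib)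

lemma hermitian_dot_diff_left: "hermitian_dot (a - b) c = hermitian_dot a c - hermitian_dot b c"
  by (simp add: hermitian_dot_def algebra_simps sum_subtractf)

lemma hermitian_dot_diff_right: "hermitian_dot a (b - c) = hermitian_dot a b - hermitian_dot a c"
  by (simp add: hermitian_dot_def algebra_simps sum_subtractf)

lemma hermitian_dot_scale_left: "hermitian_dot (k *s a) b = k * hermitian_dot a b"
  by (simp add: hermitian_dot_def sum_distrib_left mult.assoc)

lemma hermitian_dot_scaleR_left: "hermitian_dot (k *\<^sub>R a) b = of_real k * hermitian_dot a b"
  by (simp add: hermitian_dot_def sum_distrib_left mult.assoc scaleR_conv_of_real[where 'a=complex])

lemma hermitian_dot_self: "hermitian_dot a a = of_real ((norm a)\<^sup>2)"
proof -
  have "Im (hermitian_dot a a) = 0"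
    by (simp add: hermitian_dot_def)
  then show ?thesis
    by (simp add: complex_eq_iff Re_hermitian_dot dot_square_norm)
qed

text \<open>Rotating \<open>a\<close> by the conjugate phase of the product makes the product real
  and nonnegative, which reduces the claim to the real Cauchy-Schwarz inequality.\<close>

lemma cmod_hermitian_dot_le: "cmod (hermitian_dot a b) \<le> norm a * norm b"
proof -
  let ?h = "hermitian_dot a b"
  let ?c = "cnj (sgn ?h)"
  have "of_real (cmod ?h) = ?c * ?h"
    using complex_norm_square[of ?h]
    by (cases "?h = 0") (simp_all add: sgn_eq power2_eq_square field_simps)
  then have "cmod ?h = Re (hermitian_dot (?c *s a) b)"
    by (metis Re_complex_of_real hermitian_dot_scale_left)
  also have "\<dots> \<le> norm (?c *s a) * norm b"
    unfolding Re_hermitian_dot by (rule norm_cauchy_schwarz)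
  also have "\<dots> \<le> norm a * norm b"
    unfolding norm_scalar_mult_vec
    by (intro mult_right_mono mult_left_le_one_le) (auto simp: norm_sgn)
  finally show ?thesis .
qed

lemma continuous_on_hermitian_dot [continuous_intros]:
  "continuous_on S f \<Longrightarrow> continuous_on S (\<lambda>x. hermitian_dot (f x) b)"
  unfolding hermitian_dot_def by (intro continuous_intros)

text \<open>Centred at 0, of size sqrt s in the complex tangential directions and s in the complex
  line of \<nu>. It is invariant under complex scalars of modulus at most 1, so the mean value
  inequality over balanced sets applies to it.\<close>

definition nonisotropic_ball :: "complex ^ 'n \<Rightarrow> real \<Rightarrow> (complex ^ 'n) set" where
  "nonisotropic_ball \<nu> s = {u. (norm u)\<^sup>2 < s \<and> cmod (hermitian_dot u \<nu>) < s}"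

lemma open_nonisotropic_ball: "open (nonisotropic_ball \<nu> s)"
  unfolding nonisotropic_ball_def by (intro open_Collect_conj open_Collect_less continuous_intros)

lemma scalar_mult_in_nonisotropic_ball:
  assumes "u \<in> nonisotropic_ball \<nu> s" "cmod c \<le> 1"
  shows "c *s u \<in> nonisotropic_ball \<nu> s"
proof -
  have "cmod c * norm u \<le> norm u" "cmod c * cmod (hermitian_dot u \<nu>) \<le> cmod (hermitian_dot u \<nu>)"
    using assms(2) by (auto intro: mult_left_le_one_le)
  moreover from this(1) have "(cmod c * norm u)\<^sup>2 \<le> (norm u)\<^sup>2"
    by (intro power_mono) auto
  then have "(cmod c * norm u)\<^sup>2 < s"
    using assms(1) unfolding nonisotropic_ball_def by (blast intro: order.strict_trans1)
  ultimately show ?thesis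
    using assms by (auto simp: nonisotropic_ball_def norm_scalar_mult_vec hermitian_dot_scale_left norm_mult)
qed

section \<open>Packing bounds, and the volume and boundary measure of nonisotropic balls\<close>

text \<open>Volume comparison: the balls of radius d/2 about the points are disjoint and lie in the
  ball of radius R + d/2. The points are indexed so that separation of distinct indices is what
  counts; this allows counting translates of projected points.\<close>

lemma card_separated_le:
  fixes \<Phi> :: "'i \<Rightarrow> 'a::euclidean_space"
  assumes I: "finite I" and sub: "\<And>i. i \<in> I \<Longrightarrow> dist x0 (\<Phi> i) \<le> R"
    and sep: "\<And>i j. i \<in> I \<Longrightarrow> j \<in> I \<Longrightarrow> i \<noteq> j \<Longrightarrow> d \<le> dist (\<Phi> i) (\<Phi> j)"
    and d: "0 < d" and R: "0 \<le> R"
  shows "real (card I) * (d / 2) ^ DIM('a) \<le> (R + d / 2) ^ DIM('a)"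
proof -
  let ?v = "unit_ball_vol (real DIM('a))"
  have "disjoint_family_on (\<lambda>i. ball (\<Phi> i) (d / 2)) I"
    unfolding disjoint_family_on_def
  proof (intro ballI impI)
    fix i j assume "i \<in> I" "j \<in> I" "i \<noteq> j"
    then have "d \<le> dist (\<Phi> i) (\<Phi> j)" by (rule sep)
    then show "ball (\<Phi> i) (d / 2) \<inter> ball (\<Phi> j) (d / 2) = {}"
      by (intro disjoint_ballI) simp
  qed
  then have "(\<Sum>i\<in>I. emeasure lborel (ball (\<Phi> i) (d / 2))) = emeasure lborel (\<Union>i\<in>I. ball (\<Phi> i) (d / 2))"
    using I by (intro sum_emeasure) auto
  also have "\<dots> \<le> emeasure lborel (ball x0 (R + d / 2))"
  proof (intro emeasure_mono UN_least subsetI)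
    fix i x assume i: "i \<in> I" and x: "x \<in> ball (\<Phi> i) (d / 2)"
    have "dist x0 x \<le> dist x0 (\<Phi> i) + dist (\<Phi> i) x" by (rule dist_triangle)
    with sub[OF i] x show "x \<in> ball x0 (R + d / 2)" by simp
  qed simp
  finally have "ennreal (real (card I) * (?v * (d / 2) ^ DIM('a))) \<le> ennreal (?v * (R + d / 2) ^ DIM('a))"
    using d R by (simp add: emeasure_ball ennreal_of_nat_eq_real_of_nat ennreal_mult)
  then have "?v * (real (card I) * (d / 2) ^ DIM('a)) \<le> ?v * (R + d / 2) ^ DIM('a)"
    using d R by (subst (asm) ennreal_le_iff) (auto simp: mult_ac)
  then show ?thesis
    by (subst (asm) mult_le_cancel_left_pos) auto
qed

text \<open>The packing bound limits the cardinality of separated subsets of a bounded set. One of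
  greatest cardinality cannot be enlarged, so every point of \<open>S\<close> is within
  \<open>d\<close> of it.\<close>

lemma maximal_separated_subset:
  fixes S :: "'a::euclidean_space set"
  assumes S: "bounded S" and d: "0 < d"
  obtains F where "finite F" "F \<subseteq> S" "\<And>p q. p \<in> F \<Longrightarrow> q \<in> F \<Longrightarrow> p \<noteq> q \<Longrightarrow> d \<le> dist p q"
    "S \<subseteq> (\<Union>p\<in>F. cball p d)"
proof -
  define P where "P = (\<lambda>F. finite F \<and> F \<subseteq> S \<and> (\<forall>p\<in>F. \<forall>q\<in>F. p \<noteq> q \<longrightarrow> d \<le> dist p q))"
  obtain R where R: "R > 0" "\<forall>x\<in>S. norm x \<le> R"
    using S unfolding bounded_pos by blast
  define b where "b = nat \<lceil>(R + d / 2) ^ DIM('a) / (d / 2) ^ DIM('a)\<rceil>"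
  have bound: "card F \<le> b" if F: "P F" for F
  proof -
    have "real (card F) * (d / 2) ^ DIM('a) \<le> (R + d / 2) ^ DIM('a)"
    proof (rule card_separated_le[where \<Phi>="\<lambda>x. x" and ?x0.0=0])
      show "finite F" "0 < d" "0 \<le> R" using F d R(1) by (simp_all add: P_def)
      show "dist 0 p \<le> R" if "p \<in> F" for p using F R(2) that by (auto simp: P_def)
      show "d \<le> dist p q" if "p \<in> F" "q \<in> F" "p \<noteq> q" for p q using F that by (simp add: P_def)
    qed
    then have "real (card F) \<le> (R + d / 2) ^ DIM('a) / (d / 2) ^ DIM('a)"
      using d by (subst pos_le_divide_eq) auto
    also have "\<dots> \<le> real b" unfolding b_def by (rule real_nat_ceiling_ge)
    finally show ?thesis by (simp only: of_nat_le_iff)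
  qed
  have "P {}" by (simp add: P_def)
  then have "\<exists>F. P F \<and> (\<forall>G. P G \<longrightarrow> card G \<le> card F)"
    by (rule ex_has_greatest_nat[where b="Suc b"]) (use bound in \<open>simp add: less_Suc_eq_le\<close>)
  then obtain F where F: "P F" "\<And>G. P G \<Longrightarrow> card G \<le> card F" by (elim exE conjE) simp
  have "S \<subseteq> (\<Union>p\<in>F. cball p d)"
  proof (rule subsetI, rule ccontr)
    fix x assume x: "x \<in> S" and n: "x \<notin> (\<Union>p\<in>F. cball p d)"
    then have far: "d < dist p x" "d < dist x p" if "p \<in> F" for p
      using that by (auto simp: dist_commute)
    have "x \<notin> F" using n d by auto
    have "P (insert x F)"
      using F(1) x far[THEN less_imp_le] unfolding P_def by blast
    then have "card (insert x F) \<le> card F" by (rule F(2))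
    moreover have "finite F" using F(1) by (simp add: P_def)
    ultimately show False using \<open>x \<notin> F\<close> by simp
  qed
  moreover have "finite F" "F \<subseteq> S" "\<And>p q. p \<in> F \<Longrightarrow> q \<in> F \<Longrightarrow> p \<noteq> q \<Longrightarrow> d \<le> dist p q"
    using F(1) unfolding P_def by blast+
  ultimately show thesis by (intro that)
qed

lemma hausdorff_premeasure_finite_cover:
  fixes S :: "'a::euclidean_space set"
  assumes F: "finite F" "S \<subseteq> (\<Union>p\<in>F. cball p \<eta>)" and \<eta>: "0 \<le> \<eta>" "2 * \<eta> \<le> \<delta>"
  shows "hausdorff_premeasure m \<delta> S \<le> ennreal (real (card F) * (unit_ball_vol (real m) * \<eta> ^ m))"
proof -
  obtain e where e: "bij_betw e {0..<card F} F" using ex_bij_betw_nat_finite[OF F(1)] by blast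
  \<comment> \<open>The finite cover is padded with empty sets, which have weight 0, to the sequence
    that the premeasure asks for.\<close>
  define C where "C = (\<lambda>i. if i < card F then cball (e i) \<eta> else {})"
  let ?w = "\<lambda>S::'a set. if S = {} then 0 else ennreal (unit_ball_vol (real m) * (diameter S / 2) ^ m)"
  have "hausdorff_premeasure m \<delta> S \<le> (\<Sum>i. ?w (C i))"
    unfolding hausdorff_premeasure_def
  proof (rule INF_lower, safe)
    fix x assume "x \<in> S"
    then obtain p where "p \<in> F" "x \<in> cball p \<eta>" using F(2) by blast
    moreover have "p \<in> e ` {0..<card F}" using e \<open>p \<in> F\<close> by (simp add: bij_betw_def)
    then obtain i where "i < card F" "e i = p" by auto
    ultimately show "x \<in> (\<Union>i. C i)" by (auto simp: C_def)
  next
    fix i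
    show "bounded (C i)" by (simp add: C_def)
    show "diameter (C i) \<le> \<delta>" using \<eta> by (auto simp: C_def diameter_cball)
  qed
  also have "\<dots> = (\<Sum>i<card F. ?w (C i))"
    by (rule suminf_finite) (auto simp: C_def)
  also have "\<dots> \<le> (\<Sum>i<card F. ennreal (unit_ball_vol (real m) * \<eta> ^ m))"
  proof (rule sum_mono)
    fix i assume "i \<in> {..<card F}"
    show "?w (C i) \<le> ennreal (unit_ball_vol (real m) * \<eta> ^ m)"
      by (use \<eta> in \<open>auto simp: C_def diameter_cball\<close>)
  qed
  also have "\<dots> = ennreal (real (card F) * (unit_ball_vol (real m) * \<eta> ^ m))"
    using \<eta> by (simp add: ennreal_of_nat_eq_real_of_nat ennreal_mult)
  finally show ?thesis .
qed

lemma emeasure_lborel_translate: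
  fixes a :: "'a::euclidean_space"
  assumes [measurable]: "A \<in> sets borel"
  shows "emeasure lborel {x. a + x \<in> A} = emeasure lborel A"
proof -
  have "emeasure lborel {x. a + x \<in> A} = (\<integral>\<^sup>+x. indicator {x. a + x \<in> A} x \<partial>lborel)"
    by (rule nn_integral_indicator[symmetric]) measurable
  also have "\<dots> = (\<integral>\<^sup>+x. indicator A (a + x) \<partial>lborel)"
    by (simp add: indicator_def)
  also have "\<dots> = (\<integral>\<^sup>+x. indicator A x \<partial>lborel)"
    by (rule nn_integral_lborel_translate) simp
  finally show ?thesis by simp
qed

text \<open>The ball of radius \<open>\<surd>s / 4\<close> is covered by at most \<open>4 / s\<close> translates of the nonisotropic ball
  in the complex direction \<open>\<nu>\<close>.\<close>

lemma emeasure_nonisotropic_ball_ge: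
  fixes \<nu> :: "complex ^ 'n"
  assumes \<nu>: "norm \<nu> = 1" and s: "0 < s" "s \<le> 1 / 16"
  shows "ennreal (unit_ball_vol (real (2 * CARD('n))) / 4 * s * (s / 16) ^ CARD('n))
    \<le> emeasure lborel (nonisotropic_ball \<nu> s)"
proof -
  let ?B = "nonisotropic_ball \<nu> s"
  define q where "q = sqrt s"
  have q: "0 < q" "q\<^sup>2 = s" using s by (auto simp: q_def)
  have "q \<le> sqrt (1 / 16)" unfolding q_def using s by (intro real_sqrt_le_mono)
  then have q4: "q \<le> 1 / 4" by (simp add: real_sqrt_divide)
  \<comment> \<open>This is where s <= 1/16 enters: it leaves room for q/4 + s + q/4 < q in the norm
    estimate of the translates.\<close>
  have sq: "s \<le> q / 4" using q4 q by (simp add: power2_eq_square flip: q(2))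
  \<comment> \<open>The translates are indexed by a grid of mesh s/2 in the complex plane. A
    coordinate of size below q/4 is less than 1/(2q) grid steps, and rounding down costs at most one
    more.\<close>
  define N where "N = \<lfloor>1 / (2 * q) + 1\<rfloor>"
  define K where "K = {- N..N}"
  define c where "c = (\<lambda>(k, l). (of_int k + \<i> * of_int l) * of_real (s / 2))"
  have cover: "ball 0 (q / 4) \<subseteq> (\<Union>kl\<in>K \<times> K. {u. - (c kl *s \<nu>) + u \<in> ?B})"
  proof
    fix u assume "u \<in> ball (0 :: complex ^ 'n) (q / 4)"
    then have u: "norm u < q / 4" by simp
    define x where "x = hermitian_dot u \<nu>"
    define k l where "k = \<lfloor>Re x / (s / 2)\<rfloor>" and "l = \<lfloor>Im x / (s / 2)\<rfloor>"
    have x: "cmod x < q / 4"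
      using cmod_hermitian_dot_le[of u \<nu>] u \<nu> by (simp add: x_def)
    have fl: "\<bar>y - of_int \<lfloor>y / (s / 2)\<rfloor> * (s / 2)\<bar> < s / 2 \<and> \<lfloor>y / (s / 2)\<rfloor> \<in> K"
      if "\<bar>y\<bar> < q / 4" for y
    proof -
      define m where "m = \<lfloor>y / (s / 2)\<rfloor>"
      have "of_int m \<le> y / (s / 2)" "y / (s / 2) < of_int m + 1"
        by (simp_all add: m_def)
      then have m: "of_int m * (s / 2) \<le> y" "y < of_int m * (s / 2) + s / 2"
        using s by (simp_all add: field_simps)
      have "\<bar>y / (s / 2)\<bar> < 1 / (2 * q)"
        using that q s by (simp add: field_simps power2_eq_square flip: q(2))
      then have "\<bar>of_int m\<bar> \<le> 1 / (2 * q) + 1"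
        using \<open>of_int m \<le> y / (s / 2)\<close> \<open>y / (s / 2) < of_int m + 1\<close> by linarith
      then have "\<bar>m\<bar> \<le> N" unfolding N_def by linarith
      then show ?thesis using m s unfolding m_def[symmetric] by (auto simp: K_def)
    qed
    have "\<bar>Re x\<bar> < q / 4" "\<bar>Im x\<bar> < q / 4"
      using x abs_Re_le_cmod[of x] abs_Im_le_cmod[of x] by linarith+
    then have kl: "k \<in> K" "l \<in> K" "\<bar>Re x - of_int k * (s / 2)\<bar> < s / 2" "\<bar>Im x - of_int l * (s / 2)\<bar> < s / 2"
      using fl unfolding k_def l_def by blast+
    define p where "p = c (k, l)"
    have "cmod (x - p) \<le> \<bar>Re (x - p)\<bar> + \<bar>Im (x - p)\<bar>" by (rule cmod_le)
    also have "\<dots> < s" using kl by (simp add: p_def c_def)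
    finally have xp: "cmod (x - p) < s" .
    have "cmod p \<le> cmod x + cmod (x - p)" using norm_triangle_ineq4[of x "x - p"] by simp
    then have "norm (- (p *s \<nu>) + u) \<le> cmod x + cmod (x - p) + norm u"
      using norm_triangle_ineq[of "- (p *s \<nu>)" u] \<nu> by (simp add: norm_scalar_mult_vec)
    also have "\<dots> < q" using x xp u sq q(1) by linarith
    finally have "(norm (- (p *s \<nu>) + u))\<^sup>2 < q\<^sup>2" by (intro power_strict_mono) auto
    moreover have "hermitian_dot (- (p *s \<nu>) + u) \<nu> = x - p"
      using \<nu> hermitian_dot_diff_left[of u "p *s \<nu>" \<nu>]
      by (simp add: x_def hermitian_dot_scale_left hermitian_dot_self)
    ultimately have "- (p *s \<nu>) + u \<in> ?B"
      using xp q by (simp add: nonisotropic_ball_def)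
    then show "u \<in> (\<Union>kl\<in>K \<times> K. {u. - (c kl *s \<nu>) + u \<in> ?B})"
      using kl unfolding p_def by blast
  qed
  have [measurable]: "?B \<in> sets borel" by (simp add: open_nonisotropic_ball)
  have meas: "{u. v + u \<in> ?B} \<in> sets lborel" for v by measurable
  have N: "0 \<le> N" using q by (simp add: N_def)
  have "real (card (K \<times> K)) = (2 * of_int N + 1)\<^sup>2"
    using N by (simp add: K_def card_cartesian_product power2_eq_square)
  \<comment> \<open>Here 2N + 1 <= 1/q + 3 <= 2/q, because 1/q >= 4.\<close>
  also have "\<dots> \<le> (2 / q)\<^sup>2"
  proof (rule power_mono)
    have "of_int N \<le> 1 / (2 * q) + 1" by (simp add: N_def)
    moreover have "4 \<le> 1 / q" using q4 q by (simp add: field_simps)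
    ultimately show "2 * of_int N + 1 \<le> 2 / q" by simp
  qed (use N in simp)
  also have "\<dots> = 4 / s" using q by (simp add: power_divide)
  finally have card: "real (card (K \<times> K)) \<le> 4 / s" .
  have "ennreal (unit_ball_vol (real (2 * CARD('n))) * (s / 16) ^ CARD('n)) = emeasure lborel (ball (0 :: complex ^ 'n) (q / 4))"
  proof -
    have "DIM(complex ^ 'n) = 2 * CARD('n)" by simp
    moreover have "(q / 4) ^ (2 * CARD('n)) = (s / 16) ^ CARD('n)"
      unfolding power_mult using q by (simp add: power_divide)
    ultimately show ?thesis
      using emeasure_ball[of "q / 4" "0 :: complex ^ 'n"] q(1) by (simp only: less_imp_le)
  qed
  also have "\<dots> \<le> emeasure lborel (\<Union>kl\<in>K \<times> K. {u. - (c kl *s \<nu>) + u \<in> ?B})"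
    using cover meas by (intro emeasure_mono) (auto simp: K_def)
  also have "\<dots> \<le> (\<Sum>kl\<in>K \<times> K. emeasure lborel {u. - (c kl *s \<nu>) + u \<in> ?B})"
    using meas by (intro emeasure_subadditive_finite) (auto simp: K_def)
  also have "\<dots> = ennreal (real (card (K \<times> K))) * emeasure lborel ?B"
    unfolding emeasure_lborel_translate[OF \<open>?B \<in> sets borel\<close>]
    by (simp add: ennreal_of_nat_eq_real_of_nat)
  also have "\<dots> \<le> ennreal (4 / s) * emeasure lborel ?B"
    using card by (intro mult_right_mono ennreal_leI) auto
  finally have "ennreal (s / 4) * ennreal (unit_ball_vol (real (2 * CARD('n))) * (s / 16) ^ CARD('n))
      \<le> ennreal (s / 4) * (ennreal (4 / s) * emeasure lborel ?B)"
    by (rule mult_left_mono) simp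
  also have "\<dots> = emeasure lborel ?B"
    using s by (simp add: mult.assoc[symmetric] ennreal_mult[symmetric])
  finally show ?thesis
    using s by (simp add: ennreal_mult[symmetric] mult_ac)
qed

text \<open>\<open>S\<close> is a Lipschitz graph over \<open>\<nu>\<^sup>\<bottom>\<close> that has size \<open>\<surd>s\<close> in the complex tangential directions and
  \<open>s\<close> in the direction \<open>\<i>\<nu>\<close>.  A maximal separated subset of \<open>S\<close>, projected to \<open>\<nu>\<^sup>\<bottom>\<close> and then
  translated by multiples of \<open>d\<nu>\<close> and \<open>4s\<i>\<nu>\<close>, stays separated and is packed into a ball of radius
  \<open>8\<surd>s\<close>.\<close>

lemma hausdorff_outer_measure_nonisotropic_graph_le:
  fixes \<nu> :: "complex ^ 'n" and S :: "(complex ^ 'n) set"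
  assumes \<nu>: "norm \<nu> = 1" and s: "0 < s" "s \<le> 1"
    and S: "\<And>p. p \<in> S \<Longrightarrow> p - \<zeta> \<in> nonisotropic_ball \<nu> s"
    and graph: "\<And>p q. p \<in> S \<Longrightarrow> q \<in> S \<Longrightarrow> \<bar>(p - q) \<bullet> \<nu>\<bar> \<le> norm (p - q) / 2"
  shows "hausdorff_outer_measure (2 * CARD('n) - 1) S
    \<le> ennreal (unit_ball_vol (real (2 * CARD('n) - 1)) * (1024 * s) ^ CARD('n))"
  unfolding hausdorff_outer_measure_def
proof (rule SUP_least)
  fix \<delta> :: real assume "\<delta> \<in> {0<..}"
  then have \<delta>: "0 < \<delta>" by simp
  define m where "m = 2 * CARD('n) - 1"
  have Suc_m: "Suc m = 2 * CARD('n)" by (simp add: m_def)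
  define q where "q = sqrt s"
  have q: "0 < q" "q\<^sup>2 = s" "q \<le> 1" using s by (auto simp: q_def)
  have sq: "s \<le> q" using q by (simp add: power2_eq_square flip: q(2))
  \<comment> \<open>Balls of radius 2d then have diameter at most \<delta>, and d stays below the
    gap 2s that separates translates with different \<open>l\<close>.\<close>
  define d where "d = min (\<delta> / 4) (s / 2)"
  have d: "0 < d" "d \<le> s / 2" "4 * d \<le> \<delta>" using \<delta> s by (auto simp: d_def)
  have near: "norm (p - \<zeta>) < q" "cmod (hermitian_dot (p - \<zeta>) \<nu>) < s" if "p \<in> S" for p
    using S[OF that] by (auto simp: nonisotropic_ball_def q_def real_less_rsqrt)
  have "bounded S"
    by (rule bounded_subset[OF bounded_ball[of \<zeta> q]])
      (use near in \<open>auto simp: dist_norm norm_minus_commute\<close>)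
  moreover have "0 < 2 * d" using d by simp
  ultimately obtain F where F: "finite F" "F \<subseteq> S"
    "\<And>x y. x \<in> F \<Longrightarrow> y \<in> F \<Longrightarrow> x \<noteq> y \<Longrightarrow> 2 * d \<le> dist x y"
    "S \<subseteq> (\<Union>p\<in>F. cball p (2 * d))"
    by (rule maximal_separated_subset) blast
  \<comment> \<open>The translates by k d fill a length q along \<nu>, those by 4 s l a length 4q
    along i\<nu>. Their number is at least (q/d)(1/q) = 1/d, which turns a packing bound in
    dimension m + 1 into a bound on card F * d^m.\<close>
  define A B where "A = nat \<lceil>q / d\<rceil>" and "B = nat \<lceil>1 / q\<rceil>"
  have lessA: "real k * d \<le> q" if "k < A" for k
  proof -
    have "int k < \<lceil>q / d\<rceil>" using that unfolding A_def by linarith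
    then have "real k < q / d" by (simp add: less_ceiling_iff)
    then show ?thesis using d by (simp add: field_simps)
  qed
  have lessB: "real l * (4 * s) \<le> 4 * q" if "l < B" for l
  proof -
    have "int l < \<lceil>1 / q\<rceil>" using that unfolding B_def by linarith
    then have "real l < 1 / q" by (simp add: less_ceiling_iff)
    then have "real l * q \<le> 1" using q by (simp add: field_simps)
    then have "real l * q * (4 * q) \<le> 1 * (4 * q)" using q by (intro mult_right_mono) auto
    then show ?thesis by (simp add: power2_eq_square mult_ac flip: q(2))
  qed
  \<comment> \<open>Projection of \<open>p\<close> along \<nu>, followed by a complex multiple of
    \<nu> whose real part moves along \<nu> and whose imaginary part moves along i\<nu>.\<close>
  define \<Phi> where "\<Phi> = (\<lambda>(p, k, l). p - ((p - \<zeta>) \<bullet> \<nu>) *\<^sub>R \<nu> + (of_real (real k * d) + \<i> * of_real (real l * (4 * s))) *s \<nu>)"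
  let ?I = "F \<times> {..<A} \<times> {..<B}"
  \<comment> \<open>The radius 7q is made up of q for the point, q for its normal component and 5q
    for the translation.\<close>
  have packing: "real (card ?I) * (d / 2) ^ DIM(complex ^ 'n) \<le> (7 * q + d / 2) ^ DIM(complex ^ 'n)"
  proof (rule card_separated_le[where \<Phi>=\<Phi> and ?x0.0=\<zeta>])
    show "finite ?I" "0 < d" "0 \<le> 7 * q" using F d q by auto
  next
    fix i assume "i \<in> ?I"
    then obtain p k l where i: "i = (p, k, l)" "p \<in> F" "k < A" "l < B" by auto
    let ?c = "of_real (real k * d) + \<i> * of_real (real l * (4 * s))"
    have p: "norm (p - \<zeta>) < q" using near i F by blast
    have "\<bar>(p - \<zeta>) \<bullet> \<nu>\<bar> \<le> q" using Cauchy_Schwarz_ineq2[of "p - \<zeta>" \<nu>] p \<nu> by simp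
    moreover have "cmod ?c \<le> q + 4 * q"
      using lessA[OF i(3)] lessB[OF i(4)] d s
      by (intro norm_triangle_le add_mono) (simp_all only: norm_mult norm_of_real norm_ii, simp_all)
    moreover have "norm (\<Phi> i - \<zeta>) \<le> norm (p - \<zeta>) + \<bar>(p - \<zeta>) \<bullet> \<nu>\<bar> + cmod ?c"
    proof -
      have "\<Phi> i - \<zeta> = (p - \<zeta>) - ((p - \<zeta>) \<bullet> \<nu>) *\<^sub>R \<nu> + ?c *s \<nu>" by (simp add: \<Phi>_def i)
      moreover have "norm (((p - \<zeta>) \<bullet> \<nu>) *\<^sub>R \<nu>) = \<bar>(p - \<zeta>) \<bullet> \<nu>\<bar>" "norm (?c *s \<nu>) = cmod ?c"
        using \<nu> by (simp_all only: norm_scaleR norm_scalar_mult_vec mult_1_right)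
      moreover have "norm (a - b + e) \<le> norm a + norm b + norm e" for a b e :: "complex ^ 'n"
        using norm_triangle_ineq[of "a - b" e] norm_triangle_ineq4[of a b] by linarith
      ultimately show ?thesis by metis
    qed
    ultimately show "dist \<zeta> (\<Phi> i) \<le> 7 * q"
      using p unfolding dist_norm norm_minus_commute[of \<zeta>] by linarith
  next
    fix i j assume I: "i \<in> ?I" "j \<in> ?I" "i \<noteq> j"
    obtain p k l where i: "i = (p, k, l)" "p \<in> F" using I(1) by auto
    obtain p' k' l' where j: "j = (p', k', l')" "p' \<in> F" using I(2) by auto
    have ij: "(p, k, l) \<noteq> (p', k', l')" using I(3) i j by simp
    have pS: "p \<in> S" "p' \<in> S" using i j F by auto
    define v where "v = p - p'"
    define x y where "x = (real k - real k') * d" and "y = (real l - real l') * (4 * s)"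
    define W where "W = v - (v \<bullet> \<nu>) *\<^sub>R \<nu> + (of_real x + \<i> * of_real y) *s \<nu>"
    have "\<Phi> i - \<Phi> j = W"
    proof -
      have "of_real x + \<i> * of_real y = (of_real (real k * d) + \<i> * of_real (real l * (4 * s)))
          - (of_real (real k' * d) + \<i> * of_real (real l' * (4 * s)))"
        by (simp add: x_def y_def algebra_simps)
      moreover have "(a - b) *s \<nu> = a *s \<nu> - b *s \<nu>" for a b
        by (simp add: vec_eq_iff algebra_simps)
      moreover have "(v \<bullet> \<nu>) *\<^sub>R \<nu> = ((p - \<zeta>) \<bullet> \<nu>) *\<^sub>R \<nu> - ((p' - \<zeta>) \<bullet> \<nu>) *\<^sub>R \<nu>"
        by (simp add: v_def inner_diff_left scaleR_diff_left)
      ultimately show ?thesis by (simp only: \<Phi>_def i j W_def v_def prod.case) simp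
    qed
    then have dW: "dist (\<Phi> i) (\<Phi> j) = norm W" by (simp add: dist_norm)
    have hW: "hermitian_dot W \<nu> = hermitian_dot v \<nu> - of_real (v \<bullet> \<nu>) + (of_real x + \<i> * of_real y)"
      using \<nu> by (simp add: W_def hermitian_dot_add_left hermitian_dot_diff_left hermitian_dot_scale_left
          hermitian_dot_scaleR_left hermitian_dot_self)
    have Re: "Re (hermitian_dot W \<nu>) = x" by (simp add: hW Re_hermitian_dot)
    have Im: "Im (hermitian_dot W \<nu>) = Im (hermitian_dot v \<nu>) + y" by (simp add: hW)
    have le: "\<bar>Re (hermitian_dot W \<nu>)\<bar> \<le> norm W" "\<bar>Im (hermitian_dot W \<nu>)\<bar> \<le> norm W"
      using cmod_hermitian_dot_le[of W \<nu>] \<nu> abs_Re_le_cmod[of "hermitian_dot W \<nu>"]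
        abs_Im_le_cmod[of "hermitian_dot W \<nu>"] by auto
    have int: "1 \<le> \<bar>real a - real b\<bar>" if "a \<noteq> b" for a b :: nat
      using that by linarith
    \<comment> \<open>If \<open>l\<close> differs, the i\<nu>-components are shifted by at least 4s,
      while those of the points differ by less than 2s. If only \<open>k\<close> and possibly the
      point differ, the \<nu>-component of the difference is exactly \<open>x\<close>. Otherwise the
      points are 2d apart and the graph condition lets the projection lose at most half of
      that.\<close>
    consider "l \<noteq> l'" | "l = l'" "k \<noteq> k'" | "l = l'" "k = k'" "p \<noteq> p'" using ij by blast
    then show "d \<le> dist (\<Phi> i) (\<Phi> j)"
    proof cases
      case 1
      have "1 * (4 * s) \<le> \<bar>real l - real l'\<bar> * (4 * s)"
        using int[OF 1] s by (intro mult_right_mono) auto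
      then have "4 * s \<le> \<bar>y\<bar>" using s by (simp add: y_def abs_mult)
      moreover have "v = (p - \<zeta>) - (p' - \<zeta>)" by (simp add: v_def)
      then have "hermitian_dot v \<nu> = hermitian_dot (p - \<zeta>) \<nu> - hermitian_dot (p' - \<zeta>) \<nu>"
        by (simp only: hermitian_dot_diff_left)
      then have "cmod (hermitian_dot v \<nu>) < 2 * s"
        using norm_triangle_ineq4[of "hermitian_dot (p - \<zeta>) \<nu>" "hermitian_dot (p' - \<zeta>) \<nu>"]
          near(2)[OF pS(1)] near(2)[OF pS(2)] by simp
      ultimately show ?thesis
        using le(2) abs_Im_le_cmod[of "hermitian_dot v \<nu>"] d s unfolding dW Im by linarith
    next
      case 2
      have "1 * d \<le> \<bar>real k - real k'\<bar> * d"
        using int[OF 2(2)] d by (intro mult_right_mono) auto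
      then have "d \<le> \<bar>x\<bar>" using d by (simp add: x_def abs_mult)
      then show ?thesis using le(1) unfolding dW Re by linarith
    next
      case 3
      then have "W = v - (v \<bullet> \<nu>) *\<^sub>R \<nu>" by (simp add: W_def x_def y_def)
      then have "norm v - \<bar>v \<bullet> \<nu>\<bar> \<le> norm W"
        using norm_triangle_ineq2[of v "(v \<bullet> \<nu>) *\<^sub>R \<nu>"] \<nu> by simp
      moreover have "\<bar>v \<bullet> \<nu>\<bar> \<le> norm v / 2" unfolding v_def by (rule graph[OF pS])
      moreover have "2 * d \<le> norm v"
        using F(3)[OF i(2) j(2) 3(3)] by (simp add: v_def dist_norm)
      ultimately show ?thesis unfolding dW by linarith
    qed
  qed
  have D: "DIM(complex ^ 'n) = Suc m" by (simp add: Suc_m)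
  have "q / d \<le> real A" "1 / q \<le> real B" unfolding A_def B_def by (rule real_nat_ceiling_ge)+
  then have "(q / d) * (1 / q) \<le> real A * real B" using q d by (intro mult_mono) auto
  then have AB: "1 / d \<le> real A * real B" using q by simp
  have "real (card F) * (d ^ m / 2 ^ Suc m) = real (card F) * (1 / d) * (d / 2) ^ Suc m"
    using d by (simp add: power_divide)
  also have "\<dots> \<le> real (card F) * (real A * real B) * (d / 2) ^ Suc m"
    using AB d by (intro mult_right_mono mult_left_mono) auto
  also have "\<dots> \<le> (7 * q + d / 2) ^ Suc m"
    using packing unfolding D by (simp add: card_cartesian_product mult.assoc)
  also have "\<dots> \<le> (8 * q) ^ Suc m"
    using d sq q by (intro power_mono) auto
  also have "\<dots> = (64 * s) ^ CARD('n)"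
    unfolding Suc_m power_mult using q by (simp add: power_mult_distrib)
  finally have "real (card F) * d ^ m \<le> 2 ^ Suc m * (64 * s) ^ CARD('n)"
    by (simp only: times_divide_eq_right pos_divide_le_eq zero_less_power zero_less_numeral mult.commute)
  then have "2 ^ m * (real (card F) * d ^ m) \<le> 2 ^ m * (2 ^ Suc m * (64 * s) ^ CARD('n))"
    by (intro mult_left_mono) auto
  then have "real (card F) * (2 * d) ^ m \<le> 2 ^ m * 2 ^ Suc m * (64 * s) ^ CARD('n)"
    by (simp add: power_mult_distrib mult_ac)
  \<comment> \<open>Enlarging 2^m to 2^(m+1) = 4^n makes everything an n-th power, with base 4 * 4 *
    64 s = 1024 s.\<close>
  also have "\<dots> \<le> 2 ^ Suc m * 2 ^ Suc m * (64 * s) ^ CARD('n)"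
    using s by (intro mult_right_mono) auto
  also have "\<dots> = (1024 * s) ^ CARD('n)"
    unfolding Suc_m power_mult power_mult_distrib[symmetric] by simp
  finally have card: "real (card F) * (2 * d) ^ m \<le> (1024 * s) ^ CARD('n)" .
  have "hausdorff_premeasure m \<delta> S \<le> ennreal (real (card F) * (unit_ball_vol (real m) * (2 * d) ^ m))"
    using F(1,4) d by (intro hausdorff_premeasure_finite_cover) auto
  also have "real (card F) * (unit_ball_vol (real m) * (2 * d) ^ m) = unit_ball_vol (real m) * (real (card F) * (2 * d) ^ m)"
    by simp
  also have "ennreal \<dots> \<le> ennreal (unit_ball_vol (real m) * (1024 * s) ^ CARD('n))"
    by (intro ennreal_leI mult_left_mono card) auto
  finally show "hausdorff_premeasure (2 * CARD('n) - 1) \<delta> S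
      \<le> ennreal (unit_ball_vol (real (2 * CARD('n) - 1)) * (1024 * s) ^ CARD('n))"
    unfolding m_def .
qed

section \<open>Vitali covering and Hausdorff measure\<close>

text \<open>Maximality (Zorn) is taken among the disjoint subfamilies \<open>F\<close> with the property that each \<open>A i\<close>
  meeting a member of \<open>F\<close> meets one of at least half its size.\<close>

lemma vitali_disjoint_subfamily:
  fixes A :: "'i \<Rightarrow> 'b set" and s :: "'i \<Rightarrow> real"
  assumes s: "\<And>i. i \<in> K \<Longrightarrow> 0 < s i" "\<And>i. i \<in> K \<Longrightarrow> s i \<le> b"
    and ne: "\<And>i. i \<in> K \<Longrightarrow> A i \<noteq> {}"
  obtains C where "C \<subseteq> K" "disjoint_family_on A C"
    "\<And>i. i \<in> K \<Longrightarrow> \<exists>j\<in>C. A i \<inter> A j \<noteq> {} \<and> s i \<le> 2 * s j"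
proof -
  define good where "good = (\<lambda>F i. \<exists>j\<in>F. A i \<inter> A j \<noteq> {} \<and> s i \<le> 2 * s j)"
  define P where "P = {F. F \<subseteq> K \<and> disjoint_family_on A F \<and>
    (\<forall>i\<in>K. (\<exists>j\<in>F. A i \<inter> A j \<noteq> {}) \<longrightarrow> good F i)}"
  have "\<exists>F\<in>P. \<forall>X\<in>P. F \<subseteq> X \<longrightarrow> X = F"
  proof (rule subset_Zorn_nonempty)
    have "{} \<in> P" by (simp add: P_def disjoint_family_on_def)
    then show "P \<noteq> {}" by blast
  next
    fix \<C> assume \<C>: "\<C> \<noteq> {}" "subset.chain P \<C>"
    then have sub: "\<And>F. F \<in> \<C> \<Longrightarrow> F \<in> P" and tot: "\<And>F G. F \<in> \<C> \<Longrightarrow> G \<in> \<C> \<Longrightarrow> F \<subseteq> G \<or> G \<subseteq> F"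
      by (auto simp: subset_chain_def)
    have "disjoint_family_on A (\<Union>\<C>)"
      unfolding disjoint_family_on_def
    proof (intro ballI impI)
      fix i j assume "i \<in> \<Union>\<C>" "j \<in> \<Union>\<C>" and ij: "i \<noteq> j"
      then obtain F G where FG: "F \<in> \<C>" "G \<in> \<C>" "i \<in> F" "j \<in> G" by blast
      then obtain H where "H \<in> \<C>" "i \<in> H" "j \<in> H" using tot[OF FG(1,2)] by blast
      then show "A i \<inter> A j = {}"
        using sub[of H] ij unfolding P_def disjoint_family_on_def by blast
    qed
    moreover have "\<Union>\<C> \<subseteq> K" using sub unfolding P_def by blast
    moreover have "good (\<Union>\<C>) i" if i: "i \<in> K" "\<exists>j\<in>\<Union>\<C>. A i \<inter> A j \<noteq> {}" for i
    proof -
      obtain F where "F \<in> \<C>" "\<exists>j\<in>F. A i \<inter> A j \<noteq> {}" using i(2) by blast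
      then have "good F i" using sub[of F] i(1) unfolding P_def by blast
      then show ?thesis using \<open>F \<in> \<C>\<close> unfolding good_def by blast
    qed
    ultimately show "\<Union>\<C> \<in> P" unfolding P_def by blast
  qed
  then obtain F where F: "F \<in> P" and max: "\<And>X. X \<in> P \<Longrightarrow> F \<subseteq> X \<Longrightarrow> X = F" by blast
  have FK: "F \<subseteq> K" "disjoint_family_on A F"
    and Fg: "\<And>i. i \<in> K \<Longrightarrow> \<exists>j\<in>F. A i \<inter> A j \<noteq> {} \<Longrightarrow> good F i"
    using F unfolding P_def by blast+
  \<comment> \<open>The indices whose sets miss all of \<open>F\<close>. If any were left, one of
    more than half the supremum of their sizes could be added: it is a valid partner for every
    remaining set that meets it, against maximality of \<open>F\<close>.\<close>
  define R where "R = {i \<in> K. \<forall>j\<in>F. A i \<inter> A j = {}}"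
  have "R = {}"
  proof (rule ccontr)
    assume R: "R \<noteq> {}"
    have bdd: "bdd_above (s ` R)" using s(2) by (intro bdd_aboveI[of _ b]) (auto simp: R_def)
    obtain i0 where "i0 \<in> R" using R by blast
    then have "0 < s i0" using s(1) by (simp add: R_def)
    also have "s i0 \<le> (SUP i\<in>R. s i)" using \<open>i0 \<in> R\<close> bdd by (intro cSUP_upper)
    finally have "(SUP i\<in>R. s i) / 2 < (SUP i\<in>R. s i)" by simp
    then obtain i where i: "i \<in> R" "(SUP i\<in>R. s i) / 2 < s i"
      using less_cSUP_iff[OF R bdd] by blast
    have half: "s k \<le> 2 * s i" if "k \<in> R" for k
    proof -
      have "s k \<le> (SUP i\<in>R. s i)" using that bdd by (intro cSUP_upper)
      then show ?thesis using i(2) by simp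
    qed
    have iK: "i \<in> K" and iF: "\<And>j. j \<in> F \<Longrightarrow> A i \<inter> A j = {}" using i(1) by (auto simp: R_def)
    have "insert i F \<in> P"
      unfolding P_def mem_Collect_eq
    proof (intro conjI ballI impI)
      show "insert i F \<subseteq> K" using FK iK by blast
      show "disjoint_family_on A (insert i F)"
        using FK(2) iF unfolding disjoint_family_on_def by blast
      fix k assume k: "k \<in> K" "\<exists>j\<in>insert i F. A k \<inter> A j \<noteq> {}"
      show "good (insert i F) k"
      proof (cases "k \<in> R")
        case True
        then have "\<forall>j\<in>F. A k \<inter> A j = {}" by (simp add: R_def)
        then have "A k \<inter> A i \<noteq> {}" using k(2) by blast
        then show ?thesis using half[OF True] unfolding good_def by blast
      next
        case False
        then have "\<exists>j\<in>F. A k \<inter> A j \<noteq> {}" using k(1) by (simp add: R_def)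
        then have "good F k" by (rule Fg[OF k(1)])
        then show ?thesis unfolding good_def by blast
      qed
    qed
    then have "insert i F = F" by (rule max) blast
    then have "A i \<inter> A i = {}" using iF by blast
    then show False using ne[OF iK] by blast
  qed
  then have "\<exists>j\<in>F. A i \<inter> A j \<noteq> {} \<and> s i \<le> 2 * s j" if "i \<in> K" for i
    using Fg[OF that] that unfolding good_def R_def by blast
  with FK show thesis by (rule that)
qed

lemma hausdorff_outer_measure_mono:
  "A \<subseteq> B \<Longrightarrow> hausdorff_outer_measure d A \<le> hausdorff_outer_measure d B"
  unfolding hausdorff_outer_measure_def by (intro SUP_mono' hausdorff_premeasure_mono)

lemma hausdorff_outer_measure_empty: "hausdorff_outer_measure d {} = 0"
  by (simp add: hausdorff_outer_measure_def hausdorff_premeasure_empty cong: SUP_cong_simp)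

text \<open>\<open>countably_subadditive\<close> speaks of disjoint sequences only; passing to
  \<open>disjointed\<close> and monotonicity give the general case.\<close>

lemma hausdorff_outer_measure_UN:
  "hausdorff_outer_measure d (\<Union>n. A n) \<le> (\<Sum>n::nat. hausdorff_outer_measure d (A n))"
proof -
  have "hausdorff_outer_measure d (\<Union>n. disjointed A n)
      \<le> (\<Sum>n. hausdorff_outer_measure d (disjointed A n))"
    using outer_measure_space_hausdorff_outer_measure[of UNIV d] disjoint_family_disjointed[of A]
    unfolding outer_measure_space_def countably_subadditive_def by auto
  also have "\<dots> \<le> (\<Sum>n. hausdorff_outer_measure d (A n))"
    by (intro suminf_le hausdorff_outer_measure_mono disjointed_subset) auto
  finally show ?thesis by (simp only: UN_disjointed_eq)
qed

lemma hausdorff_outer_measure_UN_null: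
  assumes "countable I" "\<And>i. i \<in> I \<Longrightarrow> hausdorff_outer_measure d (A i) = 0"
  shows "hausdorff_outer_measure d (\<Union>i\<in>I. A i) = 0"
proof -
  define B where "B = (\<lambda>n. if n \<in> to_nat_on I ` I then A (from_nat_into I n) else {})"
  have "hausdorff_outer_measure d (B n) = 0" for n
    using assms by (auto simp: B_def hausdorff_outer_measure_empty)
  then have "hausdorff_outer_measure d (\<Union>n. B n) = 0"
    using hausdorff_outer_measure_UN[of d B] by simp
  moreover have "(\<Union>i\<in>I. A i) \<subseteq> (\<Union>n. B n)"
  proof
    fix x assume "x \<in> (\<Union>i\<in>I. A i)"
    then obtain i where "i \<in> I" "x \<in> A i" by blast
    then have "x \<in> B (to_nat_on I i)" using assms(1) by (simp add: B_def)
    then show "x \<in> (\<Union>n. B n)" by blast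
  qed
  ultimately show ?thesis
    using hausdorff_outer_measure_mono[of "\<Union>i\<in>I. A i" "\<Union>n. B n" d] by simp
qed

text \<open>The summation step of a Vitali argument: the \<open>S j\<close> are the enlarged sets
  that cover \<open>E\<close>, while the original \<open>A j\<close> are disjoint, so their masses
  add up to at most that of \<open>N\<close>.\<close>

lemma hausdorff_outer_measure_le_disjoint:
  assumes C: "countable C" "disjoint_family_on A C"
    and A: "\<And>j. j \<in> C \<Longrightarrow> A j \<in> sets \<mu>" "\<And>j. j \<in> C \<Longrightarrow> A j \<subseteq> N" and N: "N \<in> sets \<mu>"
    and le: "\<And>j. j \<in> C \<Longrightarrow> hausdorff_outer_measure d (S j) \<le> c * emeasure \<mu> (A j)"
    and E: "E \<subseteq> (\<Union>j\<in>C. S j)"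
  shows "hausdorff_outer_measure d E \<le> c * emeasure \<mu> N"
proof -
  let ?J = "to_nat_on C ` C"
  define A' where "A' = (\<lambda>n. if n \<in> ?J then A (from_nat_into C n) else {})"
  define S' where "S' = (\<lambda>n. if n \<in> ?J then S (from_nat_into C n) else {})"
  have A': "A' n = {} \<or> (\<exists>j\<in>C. A' n = A j)" for n
    using C(1) by (cases "n \<in> ?J") (auto simp: A'_def)
  have A's: "A' n \<in> sets \<mu>" and A'N: "A' n \<subseteq> N" for n
    using A'[of n] A by auto
  have "E \<subseteq> (\<Union>n. S' n)"
  proof
    fix x assume "x \<in> E"
    then obtain j where "j \<in> C" "x \<in> S j" using E by blast
    then have "x \<in> S' (to_nat_on C j)" using C(1) by (simp add: S'_def)
    then show "x \<in> (\<Union>n. S' n)" by blast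
  qed
  then have "hausdorff_outer_measure d E \<le> hausdorff_outer_measure d (\<Union>n. S' n)"
    by (rule hausdorff_outer_measure_mono)
  also have "\<dots> \<le> (\<Sum>n. hausdorff_outer_measure d (S' n))" by (rule hausdorff_outer_measure_UN)
  also have "\<dots> \<le> (\<Sum>n. c * emeasure \<mu> (A' n))"
  proof (rule suminf_le)
    fix n
    show "hausdorff_outer_measure d (S' n) \<le> c * emeasure \<mu> (A' n)"
    proof (cases "n \<in> ?J")
      case True
      then have "from_nat_into C n \<in> C" using C(1) by auto
      then show ?thesis using le True by (simp add: S'_def A'_def)
    qed (simp add: S'_def hausdorff_outer_measure_empty)
  qed simp_all
  also have "\<dots> = c * (\<Sum>n. emeasure \<mu> (A' n))" by simp
  also have "(\<Sum>n. emeasure \<mu> (A' n)) = emeasure \<mu> (\<Union>n. A' n)"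
  proof (rule suminf_emeasure)
    show "range A' \<subseteq> sets \<mu>" using A's by blast
    show "disjoint_family A'"
      unfolding disjoint_family_on_def
    proof (intro ballI impI)
      fix a b :: nat assume "a \<noteq> b"
      show "A' a \<inter> A' b = {}"
      proof (cases "a \<in> ?J \<and> b \<in> ?J")
        case True
        then obtain i j where ij: "i \<in> C" "a = to_nat_on C i" "j \<in> C" "b = to_nat_on C j"
          by (elim conjE imageE)
        then have "i \<noteq> j" using \<open>a \<noteq> b\<close> by metis
        then have "A i \<inter> A j = {}" by (rule disjoint_family_onD[OF C(2) ij(1,3)])
        moreover have "A' a = A i" "A' b = A j" using ij C(1) by (simp_all add: A'_def)
        ultimately show ?thesis by (simp only:)
      next
        case False
        then have "A' a = {} \<or> A' b = {}" unfolding A'_def by argo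
        then show ?thesis by blast
      qed
    qed
  qed
  also have "emeasure \<mu> (\<Union>n. A' n) \<le> emeasure \<mu> N"
    by (intro emeasure_mono N UN_least A'N)
  finally show ?thesis by (simp add: mult_left_mono)
qed

section \<open>Local geometry of the boundary\<close>

text \<open>The quantitative content of C^2 regularity near a boundary point: \<open>r\<close> is a
  defining function with gradient \<open>g\<close>, \<open>L\<close> controls the second order
  behaviour, and \<open>m\<close> and \<open>M\<close> bound the length of the gradient. By
  \<open>small\<close>, the gradient varies little across the ball compared with its length.\<close>

locale C2_patch =
  fixes \<Omega> :: "'a::euclidean_space set" and \<zeta>\<^sub>0 :: 'a and \<rho> m M L :: real
    and r :: "'a \<Rightarrow> real" and g :: "'a \<Rightarrow> 'a"
  assumes open_\<Omega>: "open \<Omega>" and center: "\<zeta>\<^sub>0 \<in> frontier \<Omega>"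
    and pos: "0 < \<rho>" "0 < m" "0 < L" and small: "4 * L * \<rho> \<le> m"
    and taylor: "x \<in> ball \<zeta>\<^sub>0 \<rho> \<Longrightarrow> y \<in> ball \<zeta>\<^sub>0 \<rho> \<Longrightarrow> \<bar>r y - r x - (y - x) \<bullet> g x\<bar> \<le> L * (norm (y - x))\<^sup>2"
    and lipschitz: "x \<in> ball \<zeta>\<^sub>0 \<rho> \<Longrightarrow> y \<in> ball \<zeta>\<^sub>0 \<rho> \<Longrightarrow> norm (g x - g y) \<le> L * norm (x - y)"
    and bounds: "x \<in> ball \<zeta>\<^sub>0 \<rho> \<Longrightarrow> m \<le> norm (g x)" "x \<in> ball \<zeta>\<^sub>0 \<rho> \<Longrightarrow> norm (g x) \<le> M"
    and mem_\<Omega>_iff: "x \<in> ball \<zeta>\<^sub>0 \<rho> \<Longrightarrow> x \<in> \<Omega> \<longleftrightarrow> r x < 0"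
    and defining_zero: "x \<in> ball \<zeta>\<^sub>0 \<rho> \<Longrightarrow> x \<in> frontier \<Omega> \<Longrightarrow> r x = 0"
    and normal_eq: "x \<in> ball \<zeta>\<^sub>0 \<rho> \<Longrightarrow> x \<in> frontier \<Omega> \<Longrightarrow> unit_outward_normal \<Omega> x = g x /\<^sub>R norm (g x)"

text \<open>Continuity of the gradient and the Hessian at \<open>\<zeta>\<^sub>0\<close> gives the
  bounds on a small ball. The Lipschitz bound is the mean value inequality for the gradient.\<close>

lemma exists_C2_patch:
  fixes \<Omega> :: "'a::euclidean_space set"
  assumes \<Omega>: "open \<Omega>" "C2_boundary \<Omega>" and \<zeta>\<^sub>0: "\<zeta>\<^sub>0 \<in> frontier \<Omega>"
  obtains \<rho> m M L r g where "C2_patch \<Omega> \<zeta>\<^sub>0 \<rho> m M L r g"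
proof -
  obtain U r where d: "local_C2_defining_function \<Omega> \<zeta>\<^sub>0 U r"
    using \<Omega> \<zeta>\<^sub>0 by (auto simp: C2_boundary_def)
  then have U: "open U" "\<zeta>\<^sub>0 \<in> U" and sub: "\<Omega> \<inter> U = {x\<in>U. r x < 0}" and C2: "C2_on U r"
    and nz: "\<And>x. x \<in> U \<Longrightarrow> \<not> GDERIV r x :> 0"
    unfolding local_C2_defining_function_def by auto
  obtain g H where g: "\<And>x. x \<in> U \<Longrightarrow> GDERIV r x :> g x"
    and H: "\<And>x. x \<in> U \<Longrightarrow> (g has_derivative blinfun_apply (H x)) (at x)"
    and contH: "continuous_on U (H :: 'a \<Rightarrow> 'a \<Rightarrow>\<^sub>L 'a)"
    using C2 unfolding C2_on_def by blast
  define L where "L = norm (H \<zeta>\<^sub>0) + 1"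
  define m where "m = norm (g \<zeta>\<^sub>0) / 2"
  define M where "M = norm (g \<zeta>\<^sub>0) + 1"
  have L: "0 < L" by (simp add: L_def add_nonneg_pos)
  have "g \<zeta>\<^sub>0 \<noteq> 0" using g[OF U(2)] nz[OF U(2)] by metis
  then have m: "0 < m" by (simp add: m_def)
  have "isCont H \<zeta>\<^sub>0" using contH U by (simp add: continuous_on_eq_continuous_at)
  then have H_ev: "\<forall>\<^sub>F x in nhds \<zeta>\<^sub>0. norm (H x) < L"
    unfolding isCont_def tendsto_at_iff_tendsto_nhds
    by (intro order_tendstoD(2)[OF tendsto_norm]) (auto simp: L_def)
  have "isCont g \<zeta>\<^sub>0" using H[OF U(2)] by (rule has_derivative_continuous)
  then have g_lim: "((\<lambda>x. norm (g x)) \<longlongrightarrow> norm (g \<zeta>\<^sub>0)) (nhds \<zeta>\<^sub>0)"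
    unfolding isCont_def tendsto_at_iff_tendsto_nhds by (rule tendsto_norm)
  have "m < norm (g \<zeta>\<^sub>0)" "norm (g \<zeta>\<^sub>0) < M" using m by (simp_all add: m_def M_def)
  note g_ev = order_tendstoD(1)[OF g_lim this(1)] order_tendstoD(2)[OF g_lim this(2)]
  have "\<forall>\<^sub>F x in nhds \<zeta>\<^sub>0. x \<in> U" using U by (rule eventually_nhds_in_open)
  with H_ev g_ev have "\<forall>\<^sub>F x in nhds \<zeta>\<^sub>0. norm (H x) < L \<and> m < norm (g x) \<and> norm (g x) < M \<and> x \<in> U"
    by eventually_elim simp
  then obtain e where e: "0 < e"
    "\<And>x. dist x \<zeta>\<^sub>0 < e \<Longrightarrow> norm (H x) < L \<and> m < norm (g x) \<and> norm (g x) < M \<and> x \<in> U"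
    unfolding eventually_nhds_metric by blast
  \<comment> \<open>The second entry of the minimum is exactly what \<open>small\<close>
    demands.\<close>
  define \<rho> where "\<rho> = min e (m / (4 * L))"
  have \<rho>: "0 < \<rho>" "4 * L * \<rho> \<le> m"
    using e(1) m L by (auto simp: \<rho>_def min_def field_simps)
  have B: "norm (H x) < L" "m < norm (g x)" "norm (g x) < M" "x \<in> U" if "x \<in> ball \<zeta>\<^sub>0 \<rho>" for x
    using e(2)[of x] that by (auto simp: \<rho>_def dist_commute)
  have lip: "norm (g x - g y) \<le> L * norm (x - y)" if "x \<in> ball \<zeta>\<^sub>0 \<rho>" "y \<in> ball \<zeta>\<^sub>0 \<rho>" for x y
  proof (rule differentiable_bound[OF convex_ball _ _ that])
    fix z assume z: "z \<in> ball \<zeta>\<^sub>0 \<rho>"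
    show "(g has_derivative blinfun_apply (H z)) (at z within ball \<zeta>\<^sub>0 \<rho>)"
      using H[OF B(4)[OF z]] by (rule has_derivative_at_withinI)
    show "onorm (blinfun_apply (H z)) \<le> L"
      using B(1)[OF z] by (simp add: norm_blinfun.rep_eq)
  qed
  have tay: "\<bar>r y - r x - (y - x) \<bullet> g x\<bar> \<le> L * (norm (y - x))\<^sup>2"
    if xy: "x \<in> ball \<zeta>\<^sub>0 \<rho>" "y \<in> ball \<zeta>\<^sub>0 \<rho>" for x y
  proof -
    let ?S = "closed_segment x y"
    have S: "?S \<subseteq> ball \<zeta>\<^sub>0 \<rho>" using xy by (intro closed_segment_subset convex_ball)
    \<comment> \<open>The mean value inequality along the segment, for \<open>r\<close> minus its
      linear part at \<open>x\<close>: the gradient of this difference is g z - g x, of length at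
      most L |y - x|.\<close>
    have "norm ((r y - y \<bullet> g x) - (r x - x \<bullet> g x)) \<le> (L * norm (y - x)) * norm (y - x)"
    proof (rule differentiable_bound[of ?S "\<lambda>z. r z - z \<bullet> g x" "\<lambda>z h. h \<bullet> (g z - g x)"])
      fix z assume z: "z \<in> ?S"
      have "(r has_derivative (\<lambda>h. h \<bullet> g z)) (at z)"
        using g[OF B(4)[OF subsetD[OF S z]]] by (simp add: gderiv_def)
      then have "((\<lambda>z. r z - z \<bullet> g x) has_derivative (\<lambda>h. h \<bullet> g z - h \<bullet> g x)) (at z)"
        by (intro derivative_intros)
      then show "((\<lambda>z. r z - z \<bullet> g x) has_derivative (\<lambda>h. h \<bullet> (g z - g x))) (at z within ?S)"
        by (simp add: inner_diff_right has_derivative_at_withinI)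
      have "norm (g z - g x) \<le> L * norm (z - x)" using S z xy by (intro lip) auto
      also have "\<dots> \<le> L * norm (y - x)"
        using segment_bound(1)[OF z] L by (intro mult_left_mono) auto
      finally have "norm (g z - g x) \<le> L * norm (y - x)" .
      then show "onorm (\<lambda>h. h \<bullet> (g z - g x)) \<le> L * norm (y - x)"
      proof (intro onorm_bound)
        fix h
        have "norm (h \<bullet> (g z - g x)) \<le> norm h * norm (g z - g x)"
          using Cauchy_Schwarz_ineq2 by simp
        also have "\<dots> \<le> norm h * (L * norm (y - x))"
          using \<open>norm (g z - g x) \<le> L * norm (y - x)\<close> by (rule mult_left_mono) simp
        finally show "norm (h \<bullet> (g z - g x)) \<le> L * norm (y - x) * norm h" by (simp add: mult_ac)
      qed (use L in simp)
    qed auto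
    then show ?thesis by (simp add: inner_diff_left power2_eq_square algebra_simps)
  qed
  have "C2_patch \<Omega> \<zeta>\<^sub>0 \<rho> m M L r g"
  proof
    fix x assume x: "x \<in> ball \<zeta>\<^sub>0 \<rho>"
    show "m \<le> norm (g x)" "norm (g x) \<le> M" using B[OF x] by simp_all
    show "x \<in> \<Omega> \<longleftrightarrow> r x < 0" using sub B(4)[OF x] by blast
    assume f: "x \<in> frontier \<Omega>"
    \<comment> \<open>The same \<open>U\<close> and \<open>r\<close> define \<Omega> near every
      boundary point of the ball, so all normals there come from the one field
      \<open>g\<close>.\<close>
    have dx: "local_C2_defining_function \<Omega> x U r"
      using d B(4)[OF x] by (simp add: local_C2_defining_function_def)
    show "r x = 0" by (rule local_C2_defining_function_at_frontier[OF dx \<Omega>(1) f])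
    have "is_unit_outward_normal \<Omega> x (g x /\<^sub>R norm (g x))"
      using dx g[OF B(4)[OF x]] unfolding is_unit_outward_normal_def by blast
    then show "unit_outward_normal \<Omega> x = g x /\<^sub>R norm (g x)"
      by (rule is_unit_outward_normal_unique[OF \<Omega>(1) f is_unit_outward_normal_unit_outward_normal[OF \<Omega> f]])
  qed (fact \<Omega> \<zeta>\<^sub>0 \<rho> m L tay lip)+
  then show thesis by (rule that)
qed

context C2_patch
begin

abbreviation "\<nu> \<equiv> unit_outward_normal \<Omega>"

lemma norm_normal:
  assumes "x \<in> ball \<zeta>\<^sub>0 \<rho>" "x \<in> frontier \<Omega>"
  shows "norm (\<nu> x) = 1" "g x = norm (g x) *\<^sub>R \<nu> x"
proof -
  have "g x \<noteq> 0" using bounds(1)[OF assms(1)] pos(2) by auto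
  then show "norm (\<nu> x) = 1" "g x = norm (g x) *\<^sub>R \<nu> x"
    by (simp_all add: normal_eq[OF assms])
qed

text \<open>The vector |g x| (\<nu> x - \<nu> y) splits into the change of \<open>g\<close> and the
  change of its length, each at most L |x - y|; the length of g x is at least m.\<close>

lemma normal_lipschitz:
  assumes x: "x \<in> ball \<zeta>\<^sub>0 \<rho>" "x \<in> frontier \<Omega>" and y: "y \<in> ball \<zeta>\<^sub>0 \<rho>" "y \<in> frontier \<Omega>"
  shows "norm (\<nu> x - \<nu> y) \<le> 2 * L / m * norm (x - y)"
proof -
  have 1: "norm (g x) *\<^sub>R (\<nu> x - \<nu> y) = (g x - g y) + (norm (g y) - norm (g x)) *\<^sub>R \<nu> y"
    using norm_normal(2)[OF x] norm_normal(2)[OF y] by (simp add: algebra_simps)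
  have "m * norm (\<nu> x - \<nu> y) \<le> norm (g x) * norm (\<nu> x - \<nu> y)"
    using bounds(1)[OF x(1)] by (intro mult_right_mono) auto
  also have "\<dots> = norm ((g x - g y) + (norm (g y) - norm (g x)) *\<^sub>R \<nu> y)"
    unfolding 1[symmetric] by simp
  also have "\<dots> \<le> norm (g x - g y) + \<bar>norm (g y) - norm (g x)\<bar> * 1"
    using norm_normal(1)[OF y] by (intro order_trans[OF norm_triangle_ineq]) simp
  also have "\<dots> \<le> 2 * norm (g x - g y)"
    using norm_triangle_ineq3[of "g x" "g y"] by simp
  also have "\<dots> \<le> 2 * (L * norm (x - y))" using lipschitz[OF x(1) y(1)] by simp
  finally show ?thesis using pos(2) by (simp add: field_simps)
qed

text \<open>As \<open>r\<close> vanishes at \<open>p\<close> and \<open>q\<close>, Taylor's estimate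
  at \<open>q\<close> makes (p - q) . g q quadratically small, and replacing g q by g \<zeta> costs
  a Lipschitz error. Both errors are at most L \<rho> / 2 times |p - q|, which \<open>small\<close>
  compares with m. This supplies the graph condition of the Hausdorff measure bound.\<close>

lemma frontier_graph:
  assumes \<zeta>: "\<zeta> \<in> ball \<zeta>\<^sub>0 (\<rho> / 4)" "\<zeta> \<in> frontier \<Omega>"
    and p: "p \<in> ball \<zeta>\<^sub>0 (\<rho> / 4)" "p \<in> frontier \<Omega>" and q: "q \<in> ball \<zeta>\<^sub>0 (\<rho> / 4)" "q \<in> frontier \<Omega>"
  shows "\<bar>(p - q) \<bullet> \<nu> \<zeta>\<bar> \<le> norm (p - q) / 2"
proof -
  have in_ball: "x \<in> ball \<zeta>\<^sub>0 \<rho>" if "x \<in> ball \<zeta>\<^sub>0 (\<rho> / 4)" for x using that pos by auto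
  have close: "norm (x - y) \<le> \<rho> / 2" if "x \<in> ball \<zeta>\<^sub>0 (\<rho> / 4)" "y \<in> ball \<zeta>\<^sub>0 (\<rho> / 4)" for x y
    using dist_triangle[of x y \<zeta>\<^sub>0] that by (simp add: dist_norm norm_minus_commute)
  note \<zeta>' = in_ball[OF \<zeta>(1)] and p' = in_ball[OF p(1)] and q' = in_ball[OF q(1)]
  have "\<bar>r p - r q - (p - q) \<bullet> g q\<bar> \<le> L * (norm (p - q))\<^sup>2" by (rule taylor[OF q' p'])
  then have "\<bar>(p - q) \<bullet> g q\<bar> \<le> L * norm (p - q) * norm (p - q)"
    using defining_zero[OF p' p(2)] defining_zero[OF q' q(2)] by (simp add: power2_eq_square mult.assoc)
  also have "\<dots> \<le> L * (\<rho> / 2) * norm (p - q)"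
    using close[OF p(1) q(1)] pos by (intro mult_right_mono mult_left_mono) auto
  finally have 1: "\<bar>(p - q) \<bullet> g q\<bar> \<le> L * (\<rho> / 2) * norm (p - q)" .
  have "\<bar>(p - q) \<bullet> (g \<zeta> - g q)\<bar> \<le> norm (p - q) * norm (g \<zeta> - g q)" by (rule Cauchy_Schwarz_ineq2)
  also have "\<dots> \<le> norm (p - q) * (L * norm (\<zeta> - q))"
    using lipschitz[OF \<zeta>' q'] by (rule mult_left_mono) simp
  also have "\<dots> \<le> norm (p - q) * (L * (\<rho> / 2))"
    using close[OF \<zeta>(1) q(1)] pos by (intro mult_left_mono) auto
  finally have 2: "\<bar>(p - q) \<bullet> (g \<zeta> - g q)\<bar> \<le> L * (\<rho> / 2) * norm (p - q)" by (simp add: mult_ac)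
  have "m * \<bar>(p - q) \<bullet> \<nu> \<zeta>\<bar> \<le> norm (g \<zeta>) * \<bar>(p - q) \<bullet> \<nu> \<zeta>\<bar>"
    using bounds(1)[OF \<zeta>'] by (intro mult_right_mono) auto
  also have "\<dots> = \<bar>(p - q) \<bullet> g \<zeta>\<bar>"
    by (subst (2) norm_normal(2)[OF \<zeta>' \<zeta>(2)]) (simp add: abs_mult)
  also have "\<dots> \<le> \<bar>(p - q) \<bullet> (g \<zeta> - g q)\<bar> + \<bar>(p - q) \<bullet> g q\<bar>"
    unfolding inner_diff_right by linarith
  also have "\<dots> \<le> L * (\<rho> / 2) * norm (p - q) + L * (\<rho> / 2) * norm (p - q)"
    by (rule add_mono[OF 2 1])
  also have "\<dots> = (L * \<rho>) * norm (p - q)" by (simp add: algebra_simps)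
  also have "\<dots> \<le> (m / 2) * norm (p - q)"
    using small pos by (intro mult_right_mono) auto
  finally have "m * \<bar>(p - q) \<bullet> \<nu> \<zeta>\<bar> \<le> m * (norm (p - q) / 2)" by simp
  then show ?thesis using pos(2) by simp
qed

text \<open>Moving from \<open>x\<close> by s = 2 (- r x) / m along the gradient raises
  \<open>r\<close> by at least s m - L s^2 >= s m / 2 = - r x, so the segment has met the boundary.
  If s is at least \<rho>/2, the boundary point \<open>\<zeta>\<^sub>0\<close> is already close
  enough.\<close>

lemma boundary_dist_le:
  assumes x: "x \<in> \<Omega>" "x \<in> ball \<zeta>\<^sub>0 (\<rho> / 4)"
  shows "boundary_dist \<Omega> x \<le> 2 / m * (- r x)"
proof -
  have xB: "x \<in> ball \<zeta>\<^sub>0 \<rho>" using x(2) pos by auto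
  have r0: "r x < 0" using x(1) mem_\<Omega>_iff[OF xB] by simp
  define s where "s = 2 / m * (- r x)"
  have s: "0 < s" unfolding s_def using r0 pos by (intro mult_pos_pos) auto
  show ?thesis
  proof (cases "s < \<rho> / 2")
    case False
    have "boundary_dist \<Omega> x \<le> dist x \<zeta>\<^sub>0"
      unfolding boundary_dist_def by (rule infdist_le[OF center])
    then show ?thesis using False x(2) pos unfolding s_def[symmetric] by (simp add: dist_commute)
  next
    case True
    have gx: "m \<le> norm (g x)" by (rule bounds(1)[OF xB])
    define e where "e = g x /\<^sub>R norm (g x)"
    have "g x \<noteq> 0" using gx pos by auto
    then have e: "norm e = 1" "e \<bullet> g x = norm (g x)"
      by (simp_all add: e_def dot_square_norm power2_eq_square)
    define y where "y = x + s *\<^sub>R e"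
    have xy: "norm (y - x) = s" using e s by (simp add: y_def)
    have "dist \<zeta>\<^sub>0 y \<le> dist \<zeta>\<^sub>0 x + norm (y - x)"
      using dist_triangle[of \<zeta>\<^sub>0 y x] by (simp add: dist_norm norm_minus_commute)
    then have yB: "y \<in> ball \<zeta>\<^sub>0 \<rho>" using x(2) True xy pos by simp
    have "\<bar>r y - r x - (y - x) \<bullet> g x\<bar> \<le> L * s\<^sup>2" using taylor[OF xB yB] xy by simp
    moreover have "(y - x) \<bullet> g x = s * norm (g x)" by (simp add: y_def e)
    moreover have "s * m \<le> s * norm (g x)" using gx s by simp
    moreover have "L * s\<^sup>2 \<le> (m / 2) * s"
    proof -
      have "L * s \<le> L * (\<rho> / 2)" using True pos by (intro mult_left_mono) auto
      then have "L * s \<le> m / 2" using small pos by linarith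
      then have "(L * s) * s \<le> (m / 2) * s" using s by (intro mult_right_mono) auto
      then show ?thesis by (simp add: power2_eq_square mult.assoc)
    qed
    moreover have "s * m / 2 = - r x" using pos by (simp add: s_def)
    ultimately have "0 \<le> r y" by (simp add: mult.commute)
    then have "y \<notin> \<Omega>" using mem_\<Omega>_iff[OF yB] by simp
    then have "closed_segment x y \<inter> frontier \<Omega> \<noteq> {}"
      using x(1) by (intro connected_Int_frontier) auto
    then obtain z where z: "z \<in> closed_segment x y" "z \<in> frontier \<Omega>" by blast
    have "boundary_dist \<Omega> x \<le> dist x z" unfolding boundary_dist_def by (rule infdist_le[OF z(2)])
    also have "\<dots> \<le> s" using segment_bound(1)[OF z(1)] xy by (simp add: dist_norm norm_minus_commute)
    finally show ?thesis by (simp add: s_def)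
  qed
qed

text \<open>Taylor's estimate at a nearest boundary point \<open>p\<close>, where \<open>r\<close>
  vanishes. The centre \<open>\<zeta>\<^sub>0\<close> is itself a boundary point at distance below
  \<rho>/4, which keeps \<open>p\<close> inside the patch.\<close>

lemma le_boundary_dist:
  assumes x: "x \<in> ball \<zeta>\<^sub>0 (\<rho> / 4)"
  shows "- r x \<le> (M + L * \<rho>) * boundary_dist \<Omega> x"
proof -
  have xB: "x \<in> ball \<zeta>\<^sub>0 \<rho>" using x pos by auto
  obtain p where p: "p \<in> frontier \<Omega>" "boundary_dist \<Omega> x = dist x p"
    using infdist_attains_inf[OF frontier_closed, of \<Omega> x] center unfolding boundary_dist_def by blast
  have "dist x p \<le> dist x \<zeta>\<^sub>0"
    unfolding p(2)[symmetric] boundary_dist_def by (rule infdist_le[OF center])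
  then have close: "dist x p < \<rho> / 4" using x by (simp add: dist_commute)
  have pB: "p \<in> ball \<zeta>\<^sub>0 \<rho>"
    using close x dist_triangle[of \<zeta>\<^sub>0 p x] pos by simp
  have "\<bar>r x - r p - (x - p) \<bullet> g p\<bar> \<le> L * (norm (x - p))\<^sup>2" by (rule taylor[OF pB xB])
  also have "\<dots> \<le> L * (\<rho> * norm (x - p))"
    using close pos unfolding power2_eq_square dist_norm by (intro mult_left_mono mult_right_mono) auto
  finally have "\<bar>r x - r p - (x - p) \<bullet> g p\<bar> \<le> L * \<rho> * norm (x - p)" by simp
  moreover have "\<bar>(x - p) \<bullet> g p\<bar> \<le> M * norm (x - p)"
    using Cauchy_Schwarz_ineq2[of "x - p" "g p"] mult_left_mono[OF bounds(2)[OF pB] norm_ge_zero[of "x - p"]]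
    by (simp add: mult.commute)
  ultimately have "- r x \<le> M * norm (x - p) + L * \<rho> * norm (x - p)"
    using defining_zero[OF pB p(1)] by linarith
  then show ?thesis by (simp add: p(2) dist_norm algebra_simps)
qed

end

section \<open>Densities along nonisotropic balls\<close>

text \<open>Both balls contain \<open>w\<close>, and the triangle inequality settles everything
  except the change of normal from \<zeta> to \<xi>. That change is Lipschitz and is paired with w -
  \<zeta>, so it contributes a multiple of |w - \<zeta>| |\<zeta> - \<xi>|, a product of two
  quantities of order sqrt t and hence of order t.\<close>

lemma nonisotropic_ball_engulfing:
  fixes \<Omega> :: "(complex ^ 'n) set"
  assumes "C2_patch \<Omega> \<zeta>\<^sub>0 \<rho> m M L r g"
    and \<zeta>: "\<zeta> \<in> ball \<zeta>\<^sub>0 \<rho>" "\<zeta> \<in> frontier \<Omega>" and \<xi>: "\<xi> \<in> ball \<zeta>\<^sub>0 \<rho>" "\<xi> \<in> frontier \<Omega>"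
    and w: "w - \<zeta> \<in> nonisotropic_ball (unit_outward_normal \<Omega> \<zeta>) s"
      "w - \<xi> \<in> nonisotropic_ball (unit_outward_normal \<Omega> \<xi>) t"
    and s: "s \<le> 2 * t"
  shows "\<zeta> - \<xi> \<in> nonisotropic_ball (unit_outward_normal \<Omega> \<xi>) ((6 + 8 * L / m) * t)"
proof -
  interpret C2_patch \<Omega> \<zeta>\<^sub>0 \<rho> m M L r g by fact
  define a where "a = norm (w - \<zeta>)"
  define b where "b = norm (w - \<xi>)"
  define c where "c = norm (\<zeta> - \<xi>)"
  define \<Lambda> where "\<Lambda> = 2 * L / m"
  have \<Lambda>: "0 < \<Lambda>" using pos by (simp add: \<Lambda>_def)
  have nn: "0 \<le> a" "0 \<le> b" "0 \<le> c" by (simp_all add: a_def b_def c_def)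
  have ab: "a\<^sup>2 < s" "b\<^sup>2 < t" "cmod (hermitian_dot (w - \<zeta>) (\<nu> \<zeta>)) < s" "cmod (hermitian_dot (w - \<xi>) (\<nu> \<xi>)) < t"
    using w by (auto simp: nonisotropic_ball_def a_def b_def)
  have t: "0 < t" using ab(2) zero_le_power2[of b] by linarith
  have "c \<le> a + b"
    using norm_triangle_ineq4[of "w - \<xi>" "w - \<zeta>"] by (simp add: a_def b_def c_def)
  then have "c\<^sup>2 \<le> (a + b)\<^sup>2" using nn by (intro power_mono) auto
  also have "\<dots> \<le> 2 * a\<^sup>2 + 2 * b\<^sup>2" using sum_squares_bound[of a b] by (simp add: power2_sum)
  finally have c: "c\<^sup>2 < 6 * t" using ab s by linarith
  have ac: "a * c \<le> 4 * t" using sum_squares_bound[of a c] ab(1) c s by linarith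
  have "hermitian_dot (\<zeta> - \<xi>) (\<nu> \<xi>)
      = hermitian_dot (w - \<xi>) (\<nu> \<xi>) - hermitian_dot (w - \<zeta>) (\<nu> \<zeta>) + hermitian_dot (w - \<zeta>) (\<nu> \<zeta> - \<nu> \<xi>)"
    by (simp add: hermitian_dot_diff_left hermitian_dot_diff_right)
  then have "cmod (hermitian_dot (\<zeta> - \<xi>) (\<nu> \<xi>))
      \<le> cmod (hermitian_dot (w - \<xi>) (\<nu> \<xi>)) + cmod (hermitian_dot (w - \<zeta>) (\<nu> \<zeta>))
        + cmod (hermitian_dot (w - \<zeta>) (\<nu> \<zeta> - \<nu> \<xi>))"
    using norm_triangle_ineq[of "hermitian_dot (w - \<xi>) (\<nu> \<xi>) - hermitian_dot (w - \<zeta>) (\<nu> \<zeta>)" "hermitian_dot (w - \<zeta>) (\<nu> \<zeta> - \<nu> \<xi>)"]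
      norm_triangle_ineq4[of "hermitian_dot (w - \<xi>) (\<nu> \<xi>)" "hermitian_dot (w - \<zeta>) (\<nu> \<zeta>)"] by simp
  also have "cmod (hermitian_dot (w - \<zeta>) (\<nu> \<zeta> - \<nu> \<xi>)) \<le> a * norm (\<nu> \<zeta> - \<nu> \<xi>)"
    unfolding a_def by (rule cmod_hermitian_dot_le)
  also have "a * norm (\<nu> \<zeta> - \<nu> \<xi>) \<le> a * (\<Lambda> * c)"
    using normal_lipschitz[OF \<zeta> \<xi>] unfolding \<Lambda>_def c_def by (rule mult_left_mono) (rule nn)
  also have "a * (\<Lambda> * c) \<le> \<Lambda> * (4 * t)"
    using mult_left_mono[OF ac, of \<Lambda>] \<Lambda> by (simp add: mult_ac)
  finally have h: "cmod (hermitian_dot (\<zeta> - \<xi>) (\<nu> \<xi>)) < 3 * t + \<Lambda> * (4 * t)" using ab s by linarith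
  have Q: "(6 + 8 * L / m) * t = 6 * t + \<Lambda> * (4 * t)" by (simp add: \<Lambda>_def algebra_simps)
  have "0 < \<Lambda> * (4 * t)" using \<Lambda> t by simp
  then have "c\<^sup>2 < 6 * t + \<Lambda> * (4 * t)" "cmod (hermitian_dot (\<zeta> - \<xi>) (\<nu> \<xi>)) < 6 * t + \<Lambda> * (4 * t)"
    using c h t by linarith+
  then show ?thesis
    unfolding nonisotropic_ball_def mem_Collect_eq Q c_def by (rule conjI)
qed

lemma ennreal_zero_if_le_tendsto:
  fixes x :: ennreal
  assumes "\<And>k. x \<le> ennreal C * ennreal (a k)" "a \<longlonglongrightarrow> 0"
  shows "x = 0"
proof -
  have "(\<lambda>k. ennreal C * ennreal (a k)) \<longlonglongrightarrow> ennreal C * ennreal 0"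
    using assms(2) by (intro ennreal_tendsto_cmult tendsto_ennrealI) auto
  then have "x \<le> ennreal C * ennreal 0"
    by (rule LIMSEQ_le_const) (use assms(1) in auto)
  then show ?thesis by simp
qed

text \<open>Continuity from above along open neighbourhoods that shrink to \<open>S\<close>.
  Nonemptiness matters since \<open>infdist\<close> to the empty set is 0.\<close>

lemma measure_neighborhood_tendsto_0:
  fixes S :: "'a::euclidean_space set"
  assumes "finite_measure \<mu>" and sets: "sets \<mu> = sets borel"
    and S: "closed S" "S \<noteq> {}" and null: "emeasure \<mu> S = 0"
  shows "(\<lambda>k. measure \<mu> {w. infdist w S < 1 / real (Suc k)}) \<longlonglongrightarrow> 0"
proof -
  interpret finite_measure \<mu> by fact
  let ?N = "\<lambda>k. {w. infdist w S < 1 / real (Suc k)}"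
  have "open (?N k)" for k by (intro open_Collect_less continuous_intros)
  then have N: "range ?N \<subseteq> sets \<mu>" by (auto simp: sets)
  have "decseq ?N"
  proof (rule decseq_SucI, rule subsetI)
    fix k w assume "w \<in> ?N (Suc k)"
    moreover have "1 / real (Suc (Suc k)) \<le> 1 / real (Suc k)" by (simp add: frac_le)
    ultimately show "w \<in> ?N k" by simp
  qed
  then have "(\<lambda>k. measure \<mu> (?N k)) \<longlonglongrightarrow> measure \<mu> (\<Inter>k. ?N k)"
    using N by (intro finite_Lim_measure_decseq)
  moreover have "(\<Inter>k. ?N k) = S"
  proof (intro equalityI subsetI)
    fix w assume "w \<in> (\<Inter>k. ?N k)"
    then have w: "infdist w S < 1 / real (Suc k)" for k by simp
    have "infdist w S \<le> 0"
    proof (rule ccontr)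
      assume "\<not> infdist w S \<le> 0"
      then obtain k where "inverse (real (Suc k)) < infdist w S"
        using reals_Archimedean[of "infdist w S"] by auto
      then show False using w[of k] by (simp add: inverse_eq_divide)
    qed
    then show "w \<in> S" using S infdist_nonneg[of w S] in_closed_iff_infdist_zero[of S w] by simp
  qed simp
  ultimately show ?thesis using null by (simp add: measure_def)
qed

text \<open>A weak type estimate: the points with density above \<open>l\<close> at arbitrarily
  small scales have Hausdorff measure at most \<kappa>/l times the mass of each neighbourhood of the
  boundary. These masses tend to 0 because the boundary itself has mass 0.\<close>

lemma nonisotropic_density_zero:
  fixes \<Omega> :: "(complex ^ 'n) set" and \<mu> :: "(complex ^ 'n) measure"
  assumes patch: "C2_patch \<Omega> \<zeta>\<^sub>0 \<rho> m M L r g"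
    and fin: "finite_measure \<mu>" and sets: "sets \<mu> = sets borel" and null: "emeasure \<mu> (frontier \<Omega>) = 0"
  shows "hausdorff_outer_measure (2 * CARD('n) - 1) {\<zeta> \<in> frontier \<Omega> \<inter> ball \<zeta>\<^sub>0 (\<rho> / 4).
    \<not> ((\<lambda>s. measure \<mu> {w. w - \<zeta> \<in> nonisotropic_ball (unit_outward_normal \<Omega> \<zeta>) s} / s ^ CARD('n))
        \<longlongrightarrow> 0) (at_right 0)} = 0"
proof -
  interpret C2_patch \<Omega> \<zeta>\<^sub>0 \<rho> m M L r g by fact
  interpret \<mu>: finite_measure \<mu> by fact
  let ?n = "CARD('n)" and ?H = "hausdorff_outer_measure (2 * CARD('n) - 1)"
  let ?G = "frontier \<Omega> \<inter> ball \<zeta>\<^sub>0 (\<rho> / 4)"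
  define A where "A = (\<lambda>\<zeta> s. {w. w - \<zeta> \<in> nonisotropic_ball (\<nu> \<zeta>) s})"
  define E where "E = (\<lambda>l. {\<zeta> \<in> ?G. \<forall>e>0. \<exists>s. 0 < s \<and> s < e \<and> l * s ^ ?n < measure \<mu> (A \<zeta> s)})"
  define N where "N = (\<lambda>k. {w. infdist w (frontier \<Omega>) < 1 / real (Suc k)})"
  define Q where "Q = 6 + 8 * L / m"
  \<comment> \<open>The constant of the Hausdorff measure bound for balls enlarged by the engulfing
    factor \<open>Q\<close>.\<close>
  define \<kappa> where "\<kappa> = unit_ball_vol (real (2 * ?n - 1)) * (1024 * Q) ^ ?n"
  have Q: "0 < Q" using pos by (simp add: Q_def add_pos_pos)
  have \<kappa>: "0 \<le> \<kappa>"
    unfolding \<kappa>_def using Q by (intro mult_nonneg_nonneg unit_ball_vol_nonneg zero_le_power of_nat_0_le_iff) auto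
  have GB: "\<zeta> \<in> ball \<zeta>\<^sub>0 \<rho>" "\<zeta> \<in> ball \<zeta>\<^sub>0 (\<rho> / 4)" "\<zeta> \<in> frontier \<Omega>" if "\<zeta> \<in> ?G" for \<zeta>
    using that pos by auto
  have openA: "open (A \<zeta> s)" for \<zeta> s
  proof -
    have "A \<zeta> s = (\<lambda>w. w - \<zeta>) -` nonisotropic_ball (\<nu> \<zeta>) s" by (auto simp: A_def)
    then show ?thesis by (simp add: open_nonisotropic_ball open_vimage continuous_intros)
  qed
  have E0: "?H (E l) = 0" if l: "0 < l" for l
  proof (rule ennreal_zero_if_le_tendsto)
    show "(\<lambda>k. measure \<mu> (N k)) \<longlonglongrightarrow> 0"
      unfolding N_def using center by (intro measure_neighborhood_tendsto_0 fin sets null) auto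
    fix k
    \<comment> \<open>The first bound keeps the chosen balls, of Euclidean radius at most sqrt s,
      inside \<open>N k\<close>; the second ensures Q s <= 1, as the Hausdorff measure bound
      requires.\<close>
    define e where "e = min ((1 / real (Suc k))\<^sup>2) (1 / Q)"
    have e: "0 < e" using Q by (simp add: e_def)
    have "\<forall>\<zeta>\<in>E l. \<exists>s. 0 < s \<and> s < e \<and> l * s ^ ?n < measure \<mu> (A \<zeta> s)"
      using e by (simp add: E_def)
    then obtain s where s: "\<And>\<zeta>. \<zeta> \<in> E l \<Longrightarrow> 0 < s \<zeta> \<and> s \<zeta> < e \<and> l * s \<zeta> ^ ?n < measure \<mu> (A \<zeta> (s \<zeta>))"
      by metis
    let ?A = "\<lambda>\<zeta>. A \<zeta> (s \<zeta>)"
    have ne: "?A \<zeta> \<noteq> {}" if "\<zeta> \<in> E l" for \<zeta>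
    proof
      assume "?A \<zeta> = {}"
      then have "l * s \<zeta> ^ ?n < 0" using s[OF that] by simp
      moreover have "0 \<le> l * s \<zeta> ^ ?n" using s[OF that] l by simp
      ultimately show False by simp
    qed
    obtain C where C: "C \<subseteq> E l" "disjoint_family_on ?A C"
      "\<And>i. i \<in> E l \<Longrightarrow> \<exists>j\<in>C. ?A i \<inter> ?A j \<noteq> {} \<and> s i \<le> 2 * s j"
      by (rule vitali_disjoint_subfamily[of "E l" s e ?A]) (use s ne in \<open>auto intro: less_imp_le\<close>)
    have inj: "inj_on ?A C"
    proof (rule inj_onI, rule ccontr)
      fix i j assume ij: "i \<in> C" "j \<in> C" "?A i = ?A j" "i \<noteq> j"
      then have "?A i \<inter> ?A j = {}" using disjoint_family_onD[OF C(2)] by blast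
      then show False using ij ne[of j] C(1) by auto
    qed
    \<comment> \<open>Disjoint open sets in a separable space are countable in number; nonemptiness
      makes the indexing injective and carries this over to \<open>C\<close>.\<close>
    have "countable (?A ` C)"
    proof (rule countable_disjoint_open_subsets)
      show "pairwise disjnt (?A ` C)"
        unfolding pairwise_image pairwise_def disjnt_def
        using disjoint_family_onD[OF C(2)] by blast
    qed (use openA in auto)
    then have cC: "countable C" by (rule countable_image_inj_on[OF _ inj])
    define S where "S = (\<lambda>\<xi>. {p \<in> ?G. p - \<xi> \<in> nonisotropic_ball (\<nu> \<xi>) (Q * s \<xi>)})"
    show "?H (E l) \<le> ennreal (\<kappa> / l) * ennreal (measure \<mu> (N k))"
      unfolding \<mu>.emeasure_eq_measure[symmetric]
    proof (rule hausdorff_outer_measure_le_disjoint[OF cC C(2)])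
      show "?A j \<in> sets \<mu>" for j using openA by (simp add: sets)
      have "open (N k)" unfolding N_def by (intro open_Collect_less continuous_intros)
      then show "N k \<in> sets \<mu>" by (simp add: sets)
      show "E l \<subseteq> (\<Union>\<xi>\<in>C. S \<xi>)"
      proof
        fix \<zeta> assume \<zeta>: "\<zeta> \<in> E l"
        obtain \<xi> w where \<xi>: "\<xi> \<in> C" "s \<zeta> \<le> 2 * s \<xi>" and w: "w \<in> ?A \<zeta>" "w \<in> ?A \<xi>"
          using C(3)[OF \<zeta>] by blast
        have G: "\<zeta> \<in> ?G" "\<xi> \<in> ?G" using \<zeta> \<xi>(1) C(1) by (auto simp: E_def)
        have "\<zeta> - \<xi> \<in> nonisotropic_ball (\<nu> \<xi>) (Q * s \<xi>)"
          unfolding Q_def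
          using w \<xi>(2) by (intro nonisotropic_ball_engulfing[OF patch GB(1,3)[OF G(1)] GB(1,3)[OF G(2)]])
            (auto simp: A_def)
        then show "\<zeta> \<in> (\<Union>\<xi>\<in>C. S \<xi>)" using \<xi>(1) G(1) by (auto simp: S_def)
      qed
    next
      fix \<xi> assume "\<xi> \<in> C"
      then have \<xi>: "\<xi> \<in> E l" "\<xi> \<in> ?G" using C(1) by (auto simp: E_def)
      note s\<xi> = s[OF \<xi>(1)]
      show "?A \<xi> \<subseteq> N k"
      proof
        fix w assume "w \<in> ?A \<xi>"
        then have "(norm (w - \<xi>))\<^sup>2 < s \<xi>" by (simp add: A_def nonisotropic_ball_def)
        also have "\<dots> < (1 / real (Suc k))\<^sup>2" using s\<xi> by (simp add: e_def)
        finally have "norm (w - \<xi>) < 1 / real (Suc k)" by (rule power_less_imp_less_base) simp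
        moreover have "infdist w (frontier \<Omega>) \<le> norm (w - \<xi>)"
          using infdist_le[OF GB(3)[OF \<xi>(2)], of w] by (simp add: dist_norm)
        ultimately show "w \<in> N k" unfolding N_def by simp
      qed
      have Qs: "0 < Q * s \<xi>" "Q * s \<xi> \<le> 1"
      proof -
        show "0 < Q * s \<xi>" using Q s\<xi> by simp
        have "s \<xi> \<le> 1 / Q" using s\<xi> by (simp add: e_def)
        then show "Q * s \<xi> \<le> 1" using Q by (simp add: field_simps)
      qed
      have "?H (S \<xi>) \<le> ennreal (unit_ball_vol (real (2 * ?n - 1)) * (1024 * (Q * s \<xi>)) ^ ?n)"
      proof (rule hausdorff_outer_measure_nonisotropic_graph_le[where \<zeta>=\<xi> and \<nu>="\<nu> \<xi>"])
        show "norm (\<nu> \<xi>) = 1" by (rule norm_normal(1)[OF GB(1,3)[OF \<xi>(2)]])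
        show "\<bar>(p - q) \<bullet> \<nu> \<xi>\<bar> \<le> norm (p - q) / 2" if "p \<in> S \<xi>" "q \<in> S \<xi>" for p q
          using that by (intro frontier_graph GB(2,3)[OF \<xi>(2)]) (auto simp: S_def)
        show "p - \<xi> \<in> nonisotropic_ball (\<nu> \<xi>) (Q * s \<xi>)" if "p \<in> S \<xi>" for p
          using that by (simp add: S_def)
      qed (fact Qs)+
      also have "unit_ball_vol (real (2 * ?n - 1)) * (1024 * (Q * s \<xi>)) ^ ?n = \<kappa> / l * (l * s \<xi> ^ ?n)"
        using l unfolding \<kappa>_def mult.assoc[symmetric] power_mult_distrib[of "1024 * Q" "s \<xi>"] by simp
      also have "ennreal \<dots> \<le> ennreal (\<kappa> / l * measure \<mu> (?A \<xi>))"
        using s\<xi> l \<kappa> by (intro ennreal_leI mult_left_mono) auto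
      also have "\<dots> = ennreal (\<kappa> / l) * emeasure \<mu> (?A \<xi>)"
        using l \<kappa> by (subst ennreal_mult) (auto simp: \<mu>.emeasure_eq_measure)
      finally show "?H (S \<xi>) \<le> ennreal (\<kappa> / l) * emeasure \<mu> (?A \<xi>)" .
    qed
  qed
  let ?bad = "{\<zeta> \<in> ?G. \<not> ((\<lambda>s. measure \<mu> (A \<zeta> s) / s ^ ?n) \<longlongrightarrow> 0) (at_right 0)}"
  have sub: "?bad \<subseteq> (\<Union>k. E (1 / real (Suc k)))"
  \<comment> \<open>Outside \<open>E (1 / real (Suc k))\<close> the density is at most 1/(k+1) at
    all sufficiently small scales; holding for every k, this means convergence to 0.\<close>
  proof (rule subsetI, rule ccontr)
    fix \<zeta> assume \<zeta>: "\<zeta> \<in> ?bad" and no: "\<zeta> \<notin> (\<Union>k. E (1 / real (Suc k)))"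
    have "((\<lambda>s. measure \<mu> (A \<zeta> s) / s ^ ?n) \<longlongrightarrow> 0) (at_right 0)"
    proof (rule tendstoI)
      fix l :: real assume "0 < l"
      then obtain k where k: "1 / real (Suc k) < l"
        using reals_Archimedean[of l] unfolding inverse_eq_divide by blast
      have "\<zeta> \<notin> E (1 / real (Suc k))" using no by blast
      moreover have "\<zeta> \<in> ?G" using \<zeta> by blast
      ultimately have "\<not> (\<forall>e>0. \<exists>s. 0 < s \<and> s < e \<and> 1 / real (Suc k) * s ^ ?n < measure \<mu> (A \<zeta> s))"
        unfolding E_def by blast
      then obtain e where e: "e > 0"
        and nex: "\<not> (\<exists>s. 0 < s \<and> s < e \<and> 1 / real (Suc k) * s ^ ?n < measure \<mu> (A \<zeta> s))" by blast
      then have le: "measure \<mu> (A \<zeta> s) \<le> 1 / real (Suc k) * s ^ ?n" if "0 < s" "s < e" for s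
      proof -
        have "\<not> 1 / real (Suc k) * s ^ ?n < measure \<mu> (A \<zeta> s)" using nex that by blast
        then show ?thesis by (simp only: not_less)
      qed
      have "dist (measure \<mu> (A \<zeta> s) / s ^ ?n) 0 < l" if "0 < s" "s < e" for s
      proof -
        have "measure \<mu> (A \<zeta> s) / s ^ ?n \<le> 1 / real (Suc k)"
          using le[OF that] that by (subst pos_divide_le_eq) auto
        then show ?thesis using k that by (simp add: dist_real_def)
      qed
      then show "\<forall>\<^sub>F s in at_right 0. dist (measure \<mu> (A \<zeta> s) / s ^ ?n) 0 < l"
        unfolding eventually_at_right_field using e by blast
    qed
    then show False using \<zeta> by blast
  qed
  have "?H ?bad \<le> ?H (\<Union>k. E (1 / real (Suc k)))"
    by (rule hausdorff_outer_measure_mono[OF sub])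
  also have "\<dots> = 0"
    by (intro hausdorff_outer_measure_UN_null E0) auto
  finally have "?H ?bad = 0" by (simp only: le_zero_eq)
  then show ?thesis unfolding A_def .
qed

section \<open>Admissible regions\<close>

text \<open>With \<tau> the tangential distance of \<open>z\<close>, the number - r z lies between
  fixed multiples of \<tau>, and a displacement \<open>u\<close> in the small nonisotropic ball
  changes \<open>r\<close> by at most m/4 times \<tau>. The two-sided comparison of - r with the
  boundary distance then applies at z + u.\<close>

lemma admissible_region_geometry:
  fixes \<Omega> :: "(complex ^ 'n) set"
  assumes patch: "C2_patch \<Omega> \<zeta>\<^sub>0 \<rho> m M L r g"
    and \<zeta>: "\<zeta> \<in> ball \<zeta>\<^sub>0 (\<rho> / 4)" "\<zeta> \<in> frontier \<Omega>" and t: "0 < t"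
  obtains c K c\<^sub>1 c\<^sub>2 e where "0 < c" "c \<le> 1" "0 < K" "0 < c\<^sub>1" "0 < c\<^sub>2" "0 < e"
    "\<And>z. z \<in> admissible_region \<Omega> \<zeta> t \<Longrightarrow> 0 < tangential_dist \<Omega> \<zeta> z"
    "\<And>z. z \<in> admissible_region \<Omega> \<zeta> t \<Longrightarrow> tangential_dist \<Omega> \<zeta> z \<le> norm (z - \<zeta>)"
    "\<And>z u. z \<in> admissible_region \<Omega> \<zeta> t \<Longrightarrow> norm (z - \<zeta>) < e \<Longrightarrow>
      u \<in> nonisotropic_ball (unit_outward_normal \<Omega> \<zeta>) (c * tangential_dist \<Omega> \<zeta> z) \<Longrightarrow>
      z + u \<in> \<Omega> \<and>
      z + u - \<zeta> \<in> nonisotropic_ball (unit_outward_normal \<Omega> \<zeta>) (K * tangential_dist \<Omega> \<zeta> z) \<and>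
      c\<^sub>1 * tangential_dist \<Omega> \<zeta> z \<le> boundary_dist \<Omega> (z + u) \<and>
      boundary_dist \<Omega> (z + u) \<le> c\<^sub>2 * tangential_dist \<Omega> \<zeta> z"
proof -
  interpret C2_patch \<Omega> \<zeta>\<^sub>0 \<rho> m M L r g by fact
  have quarter: "x \<in> ball \<zeta>\<^sub>0 \<rho>" if "x \<in> ball \<zeta>\<^sub>0 (\<rho> / 4)" for x using that pos by auto
  note \<zeta>B = quarter[OF \<zeta>(1)]
  have M: "0 < M" using bounds[OF \<zeta>B] pos(2) by linarith
  \<comment> \<open>\<open>X\<close> adds the coefficients of the three error terms in r (z + u) - r
    z; \<open>q\<close> makes X q at most m/4, and q^2 becomes the constant
    \<open>c\<close>.\<close>
  define X where "X = M + L * sqrt t + L"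
  have X: "0 < X" using M pos t by (simp add: X_def add_pos_pos)
  define q where "q = min 1 (m / (4 * X))"
  have q: "0 < q" "q \<le> 1" "X * q \<le> m / 4"
    using X pos(2) by (auto simp: q_def min_def field_simps)
  \<comment> \<open>The bound of - r z by Y \<tau>: the normal component contributes M (1 + t), the
    Taylor remainder L t.\<close>
  define Y where "Y = M * (1 + t) + L * t"
  have Y: "0 < Y" using M pos t by (simp add: Y_def add_pos_pos)
  have C0: "0 < M + L * \<rho>" using M pos by (simp add: add_pos_pos)
  \<comment> \<open>Half the gap between \<zeta> and the edge of the smaller ball, so that both
    \<open>z\<close> and z + u stay in it.\<close>
  define d where "d = (\<rho> / 4 - dist \<zeta>\<^sub>0 \<zeta>) / 2"
  have d: "0 < d" using \<zeta>(1) by (simp add: d_def)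
  let ?T = "tangential_dist \<Omega> \<zeta>"
  have T: "0 < ?T z" "?T z \<le> boundary_dist \<Omega> z" "boundary_dist \<Omega> z \<le> norm (z - \<zeta>)" "z \<in> \<Omega>"
    "cmod (hermitian_dot (z - \<zeta>) (\<nu> \<zeta>)) < (1 + t) * ?T z" "(norm (z - \<zeta>))\<^sup>2 < t * ?T z"
    if "z \<in> admissible_region \<Omega> \<zeta> t" for z
  proof -
    show a: "z \<in> \<Omega>" "cmod (hermitian_dot (z - \<zeta>) (\<nu> \<zeta>)) < (1 + t) * ?T z" "(norm (z - \<zeta>))\<^sup>2 < t * ?T z"
      using that by (simp_all add: admissible_region_def)
    have "0 < t * ?T z" by (rule le_less_trans[OF zero_le_power2 a(3)])
    then show "0 < ?T z" using t by (simp add: zero_less_mult_iff)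
    show "?T z \<le> boundary_dist \<Omega> z" by (simp add: tangential_dist_def)
    show "boundary_dist \<Omega> z \<le> norm (z - \<zeta>)"
      using infdist_le[OF \<zeta>(2), of z] by (simp add: boundary_dist_def dist_norm)
  qed
  have inner_g: "\<bar>v \<bullet> g \<zeta>\<bar> \<le> M * cmod (hermitian_dot v (\<nu> \<zeta>))" for v
  proof -
    have "v \<bullet> g \<zeta> = norm (g \<zeta>) * (v \<bullet> \<nu> \<zeta>)"
      by (subst norm_normal(2)[OF \<zeta>B \<zeta>(2)]) simp
    then have "\<bar>v \<bullet> g \<zeta>\<bar> = norm (g \<zeta>) * \<bar>Re (hermitian_dot v (\<nu> \<zeta>))\<bar>"
      by (simp add: abs_mult Re_hermitian_dot)
    also have "\<dots> \<le> M * cmod (hermitian_dot v (\<nu> \<zeta>))"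
      using bounds(2)[OF \<zeta>B] M by (intro mult_mono abs_Re_le_cmod) auto
    finally show ?thesis .
  qed
  show thesis
  proof (rule that)
    show "0 < q\<^sup>2" "q\<^sup>2 \<le> 1" using q by (simp_all add: power_le_one)
    show "0 < 2 + 2 * t" using t by simp
    show "0 < m / (4 * (M + L * \<rho>))" using pos C0 by simp
    show "0 < 2 / m * (Y + m / 4)" using pos Y by (simp add: add_pos_pos)
    \<comment> \<open>The square is there because |u| is only of order sqrt \<tau>: from \<tau> <=
      |z - \<zeta>| < d^2 follows |u| < d.\<close>
    show "0 < min d (d\<^sup>2)" using d by simp
    show "0 < ?T z" if "z \<in> admissible_region \<Omega> \<zeta> t" for z using T[OF that] by simp
    show "?T z \<le> norm (z - \<zeta>)" if "z \<in> admissible_region \<Omega> \<zeta> t" for z using T(2,3)[OF that] by simp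
  next
    fix z u assume z: "z \<in> admissible_region \<Omega> \<zeta> t" "norm (z - \<zeta>) < min d (d\<^sup>2)"
      and u: "u \<in> nonisotropic_ball (\<nu> \<zeta>) (q\<^sup>2 * ?T z)"
    define \<tau> where "\<tau> = ?T z"
    note Tz = T[OF z(1), folded \<tau>_def]
    have u': "(norm u)\<^sup>2 < q\<^sup>2 * \<tau>" "cmod (hermitian_dot u (\<nu> \<zeta>)) < q\<^sup>2 * \<tau>"
      using u by (simp_all add: nonisotropic_ball_def \<tau>_def)
    have q2: "q\<^sup>2 \<le> q" "q\<^sup>2 \<le> 1" using q by (simp_all add: power2_eq_square mult_le_one)
    have q2\<tau>: "q\<^sup>2 * \<tau> \<le> q * \<tau>" "q\<^sup>2 * \<tau> \<le> 1 * \<tau>"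
      using q2 Tz(1) by (intro mult_right_mono; simp)+
    have "(norm u)\<^sup>2 < d\<^sup>2" using u'(1) q2\<tau>(2) Tz(2,3) z(2) by linarith
    then have ud: "norm u < d" by (rule power_less_imp_less_base) (use d in simp)
    have "dist \<zeta>\<^sub>0 z \<le> dist \<zeta>\<^sub>0 \<zeta> + norm (z - \<zeta>)"
      using dist_triangle[of \<zeta>\<^sub>0 z \<zeta>] by (simp add: dist_norm norm_minus_commute)
    moreover have "dist \<zeta>\<^sub>0 (z + u) \<le> dist \<zeta>\<^sub>0 z + norm u"
      using dist_triangle[of \<zeta>\<^sub>0 "z + u" z] by (simp add: dist_norm)
    moreover have "dist \<zeta>\<^sub>0 \<zeta> + 2 * d = \<rho> / 4" by (simp add: d_def field_simps)
    ultimately have B: "z \<in> ball \<zeta>\<^sub>0 (\<rho> / 4)" "z + u \<in> ball \<zeta>\<^sub>0 (\<rho> / 4)"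
      using z(2) ud d by (simp_all only: mem_ball)
    note B' = B[THEN quarter]
    \<comment> \<open>Both factors are of order sqrt \<tau>, so the error made by replacing g z by g
      \<zeta> against \<open>u\<close> is linear in \<tau>.\<close>
    have "norm u * norm (z - \<zeta>) \<le> (q * sqrt \<tau>) * (sqrt t * sqrt \<tau>)"
    proof (rule mult_mono)
      show "norm u \<le> q * sqrt \<tau>"
        using real_le_rsqrt[OF less_imp_le[OF u'(1)]] q by (simp add: real_sqrt_mult)
      show "norm (z - \<zeta>) \<le> sqrt t * sqrt \<tau>"
        using real_le_rsqrt[OF less_imp_le[OF Tz(6)]] by (simp add: real_sqrt_mult)
    qed (use q Tz(1) in simp_all)
    also have "\<dots> = sqrt t * q * \<tau>" using Tz(1) by (simp add: algebra_simps)
    finally have uz: "norm u * norm (z - \<zeta>) \<le> sqrt t * q * \<tau>" .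
    \<comment> \<open>The three terms are the Taylor remainder, the change of gradient from \<zeta>
      to \<open>z\<close>, and the normal component of \<open>u\<close> at \<zeta>.\<close>
    have diff: "\<bar>r (z + u) - r z\<bar> \<le> m / 4 * \<tau>"
    proof -
      have "\<bar>r (z + u) - r z - u \<bullet> g z\<bar> \<le> L * (norm u)\<^sup>2"
        using taylor[OF B'] by simp
      also have "\<dots> \<le> L * (q * \<tau>)" using u'(1) q2\<tau>(1) pos by (intro mult_left_mono) auto
      finally have 1: "\<bar>r (z + u) - r z - u \<bullet> g z\<bar> \<le> L * (q * \<tau>)" .
      have "\<bar>u \<bullet> (g z - g \<zeta>)\<bar> \<le> norm u * norm (g z - g \<zeta>)" by (rule Cauchy_Schwarz_ineq2)
      also have "\<dots> \<le> norm u * (L * norm (z - \<zeta>))"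
        using lipschitz[OF B'(1) \<zeta>B] by (rule mult_left_mono) simp
      also have "\<dots> = L * (norm u * norm (z - \<zeta>))" by simp
      also have "\<dots> \<le> L * (sqrt t * q * \<tau>)" using uz pos by (intro mult_left_mono) auto
      finally have 2: "\<bar>u \<bullet> (g z - g \<zeta>)\<bar> \<le> L * (sqrt t * q * \<tau>)" .
      have "\<bar>u \<bullet> g \<zeta>\<bar> \<le> M * cmod (hermitian_dot u (\<nu> \<zeta>))" by (rule inner_g)
      also have "\<dots> \<le> M * (q * \<tau>)" using u'(2) q2\<tau>(1) M by (intro mult_left_mono) auto
      finally have 3: "\<bar>u \<bullet> g \<zeta>\<bar> \<le> M * (q * \<tau>)" .
      have "u \<bullet> g z = u \<bullet> (g z - g \<zeta>) + u \<bullet> g \<zeta>" by (simp add: inner_diff_right)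
      then have "\<bar>r (z + u) - r z\<bar> \<le> L * (q * \<tau>) + L * (sqrt t * q * \<tau>) + M * (q * \<tau>)"
        using 1 2 3 by linarith
      also have "\<dots> = X * q * \<tau>" by (simp add: X_def algebra_simps)
      also have "\<dots> \<le> m / 4 * \<tau>" using q(3) Tz(1) by (intro mult_right_mono) auto
      finally show ?thesis .
    qed
    have "m / 2 * \<tau> \<le> m / 2 * boundary_dist \<Omega> z" using Tz(2) pos by (intro mult_left_mono) auto
    also have "\<dots> \<le> m / 2 * (2 / m * (- r z))"
      using boundary_dist_le[OF Tz(4) B(1)] pos by (intro mult_left_mono) auto
    also have "\<dots> = - r z" using pos by simp
    finally have lower: "m / 4 * \<tau> \<le> - r (z + u)" using diff by linarith
    have "- r z \<le> Y * \<tau>"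
    proof -
      have "\<bar>r z - r \<zeta> - (z - \<zeta>) \<bullet> g \<zeta>\<bar> \<le> L * (norm (z - \<zeta>))\<^sup>2" by (rule taylor[OF \<zeta>B B'(1)])
      also have "\<dots> \<le> L * (t * \<tau>)" using Tz(6) pos by (intro mult_left_mono) auto
      finally have "\<bar>r z - r \<zeta> - (z - \<zeta>) \<bullet> g \<zeta>\<bar> \<le> L * (t * \<tau>)" .
      moreover have "\<bar>(z - \<zeta>) \<bullet> g \<zeta>\<bar> \<le> M * ((1 + t) * \<tau>)"
        using inner_g[of "z - \<zeta>"] mult_left_mono[OF less_imp_le[OF Tz(5)], of M] M by linarith
      moreover have "Y * \<tau> = M * ((1 + t) * \<tau>) + L * (t * \<tau>)" by (simp add: Y_def algebra_simps)
      ultimately show ?thesis using defining_zero[OF \<zeta>B \<zeta>(2)] by linarith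
    qed
    then have upper: "- r (z + u) \<le> (Y + m / 4) * \<tau>" using diff unfolding distrib_right by linarith
    have "0 < m / 4 * \<tau>" using pos Tz(1) by simp
    then have in\<Omega>: "z + u \<in> \<Omega>" using mem_\<Omega>_iff[OF B'(2)] lower by linarith
    have "m / 4 * \<tau> \<le> (M + L * \<rho>) * boundary_dist \<Omega> (z + u)"
      using lower le_boundary_dist[OF B(2)] by linarith
    then have low: "m / (4 * (M + L * \<rho>)) * \<tau> \<le> boundary_dist \<Omega> (z + u)"
      using C0 by (simp add: field_simps)
    have "boundary_dist \<Omega> (z + u) \<le> 2 / m * (- r (z + u))" by (rule boundary_dist_le[OF in\<Omega> B(2)])
    also have "\<dots> \<le> 2 / m * ((Y + m / 4) * \<tau>)" using upper pos by (intro mult_left_mono) auto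
    finally have up: "boundary_dist \<Omega> (z + u) \<le> 2 / m * (Y + m / 4) * \<tau>" by (simp only: mult.assoc)
    have zu: "z + u - \<zeta> = (z - \<zeta>) + u" by simp
    have "(norm (z + u - \<zeta>))\<^sup>2 \<le> (norm (z - \<zeta>) + norm u)\<^sup>2"
      unfolding zu by (intro power_mono norm_triangle_ineq) simp
    also have "\<dots> \<le> 2 * (norm (z - \<zeta>))\<^sup>2 + 2 * (norm u)\<^sup>2"
      using sum_squares_bound[of "norm (z - \<zeta>)" "norm u"] by (simp add: power2_sum)
    also have "\<dots> < 2 * (t * \<tau>) + 2 * (1 * \<tau>)" using Tz(6) u'(1) q2\<tau>(2) by linarith
    also have "\<dots> = (2 + 2 * t) * \<tau>" by (simp add: algebra_simps)
    finally have n: "(norm (z + u - \<zeta>))\<^sup>2 < (2 + 2 * t) * \<tau>" .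
    have "cmod (hermitian_dot (z + u - \<zeta>) (\<nu> \<zeta>))
        \<le> cmod (hermitian_dot (z - \<zeta>) (\<nu> \<zeta>)) + cmod (hermitian_dot u (\<nu> \<zeta>))"
      unfolding zu hermitian_dot_add_left by (rule norm_triangle_ineq)
    also have "\<dots> < (1 + t) * \<tau> + 1 * \<tau>" using Tz(5) u'(2) q2\<tau>(2) by linarith
    also have "\<dots> \<le> (2 + 2 * t) * \<tau>" using t Tz(1) by (simp add: algebra_simps)
    finally have h: "cmod (hermitian_dot (z + u - \<zeta>) (\<nu> \<zeta>)) < (2 + 2 * t) * \<tau>" .
    show "z + u \<in> \<Omega> \<and> z + u - \<zeta> \<in> nonisotropic_ball (\<nu> \<zeta>) ((2 + 2 * t) * ?T z) \<and>
      m / (4 * (M + L * \<rho>)) * ?T z \<le> boundary_dist \<Omega> (z + u) \<and>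
      boundary_dist \<Omega> (z + u) \<le> 2 / m * (Y + m / 4) * ?T z"
      using in\<Omega> low up n h unfolding nonisotropic_ball_def mem_Collect_eq \<tau>_def by blast
  qed
qed

section \<open>The measure |f|^2 times the weight, and the pointwise bound it gives for f\<close>

definition bergman_density :: "real \<Rightarrow> (complex ^ 'n) set \<Rightarrow> (complex ^ 'n \<Rightarrow> complex) \<Rightarrow> complex ^ 'n \<Rightarrow> real" where
  "bergman_density \<alpha> \<Omega> f w = indicator \<Omega> w *\<^sub>R ((cmod (f w))\<^sup>2 * boundary_dist \<Omega> w powr (- \<alpha>))"

text \<open>A measure on all of C^n, extended by zero off \<Omega>, so that translates and
  neighbourhoods of the boundary can be measured without intersecting with \<Omega>.\<close>

definition bergman_measure :: "real \<Rightarrow> (complex ^ 'n) set \<Rightarrow> (complex ^ 'n \<Rightarrow> complex) \<Rightarrow> (complex ^ 'n) measure" where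
  "bergman_measure \<alpha> \<Omega> f = density lborel (\<lambda>w. ennreal (bergman_density \<alpha> \<Omega> f w))"

lemma bergman_density_nonneg: "0 \<le> bergman_density \<alpha> \<Omega> f w"
  by (simp add: bergman_density_def)

lemma bergman_density_measurable [measurable]:
  assumes "f \<in> weighted_bergman_space \<alpha> \<Omega>"
  shows "bergman_density \<alpha> \<Omega> f \<in> borel_measurable borel"
proof -
  have "integrable lborel (bergman_density \<alpha> \<Omega> f)"
    using assms unfolding weighted_bergman_space_def set_integrable_def bergman_density_def by simp
  then show ?thesis by (simp add: borel_measurable_integrable)
qed

lemma sets_bergman_measure: "sets (bergman_measure \<alpha> \<Omega> f) = sets borel"
  by (simp add: bergman_measure_def)

lemma finite_bergman_measure:
  assumes f: "f \<in> weighted_bergman_space \<alpha> \<Omega>"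
  shows "finite_measure (bergman_measure \<alpha> \<Omega> f)"
proof
  note [measurable] = bergman_density_measurable[OF f]
  have int: "integrable lborel (bergman_density \<alpha> \<Omega> f)"
    using f unfolding weighted_bergman_space_def set_integrable_def bergman_density_def by simp
  have "emeasure (bergman_measure \<alpha> \<Omega> f) (space (bergman_measure \<alpha> \<Omega> f))
      = (\<integral>\<^sup>+w. ennreal (bergman_density \<alpha> \<Omega> f w) \<partial>lborel)"
    unfolding bergman_measure_def by (subst emeasure_density) auto
  also have "\<dots> = ennreal (integral\<^sup>L lborel (bergman_density \<alpha> \<Omega> f))"
    using int by (intro nn_integral_eq_integral) (auto simp: bergman_density_nonneg)
  finally show "emeasure (bergman_measure \<alpha> \<Omega> f) (space (bergman_measure \<alpha> \<Omega> f)) \<noteq> \<infinity>" by simp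
qed

lemma bergman_measure_frontier:
  assumes "open \<Omega>" and f: "f \<in> weighted_bergman_space \<alpha> \<Omega>"
  shows "emeasure (bergman_measure \<alpha> \<Omega> f) (frontier \<Omega>) = 0"
proof -
  note [measurable] = bergman_density_measurable[OF f]
  have "bergman_density \<alpha> \<Omega> f w = 0" if "w \<in> frontier \<Omega>" for w
    using that assms(1) by (simp add: bergman_density_def frontier_def interior_open)
  then have zero: "ennreal (bergman_density \<alpha> \<Omega> f w) * indicator (frontier \<Omega>) w = 0" for w
    by (cases "w \<in> frontier \<Omega>") simp_all
  have "emeasure (bergman_measure \<alpha> \<Omega> f) (frontier \<Omega>)
      = (\<integral>\<^sup>+w. ennreal (bergman_density \<alpha> \<Omega> f w) * indicator (frontier \<Omega>) w \<partial>lborel)"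
    unfolding bergman_measure_def by (rule emeasure_density) simp_all
  then show ?thesis by (simp only: zero) simp
qed

text \<open>The power is increasing or decreasing according to the sign of \<open>a\<close>; the
  maximum covers both cases.\<close>

lemma powr_between_le:
  fixes a :: real
  assumes "0 < c\<^sub>1" "0 < \<tau>" "c\<^sub>1 * \<tau> \<le> x" "x \<le> c\<^sub>2 * \<tau>"
  shows "x powr a \<le> max (c\<^sub>1 powr a) (c\<^sub>2 powr a) * \<tau> powr a"
proof -
  have x: "0 < c\<^sub>1 * \<tau>" using assms by simp
  then have x0: "0 \<le> x" using assms(3) by linarith
  have c2: "0 < c\<^sub>2"
  proof -
    have "0 < c\<^sub>2 * \<tau>" using x assms by linarith
    then show ?thesis using assms(2) by (simp add: zero_less_mult_iff)
  qed
  show ?thesis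
  proof (cases "0 \<le> a")
    case True
    have "x powr a \<le> (c\<^sub>2 * \<tau>) powr a" using True assms x0 by (intro powr_mono2) auto
    also have "\<dots> = c\<^sub>2 powr a * \<tau> powr a" using assms c2 by (simp add: powr_mult)
    also have "\<dots> \<le> max (c\<^sub>1 powr a) (c\<^sub>2 powr a) * \<tau> powr a" by (intro mult_right_mono) auto
    finally show ?thesis .
  next
    case False
    have "x powr a \<le> (c\<^sub>1 * \<tau>) powr a" using False assms x by (intro powr_mono2') auto
    also have "\<dots> = c\<^sub>1 powr a * \<tau> powr a" using assms by (simp add: powr_mult)
    also have "\<dots> \<le> max (c\<^sub>1 powr a) (c\<^sub>2 powr a) * \<tau> powr a" by (intro mult_right_mono) auto
    finally show ?thesis .
  qed
qed

text \<open>The mean value inequality over z plus the small ball, with the lower bound for its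
  volume on the left. On the right the weight is comparable to a power of \<tau>, which turns |f|^2
  into the Bergman density, and the domain is enlarged to the ball about \<zeta>.\<close>

lemma cmod_square_le_bergman_measure:
  fixes \<Omega> :: "(complex ^ 'n) set"
  assumes \<Omega>: "open \<Omega>" and f: "f \<in> weighted_bergman_space \<alpha> \<Omega>" and \<nu>: "norm \<nu> = 1"
    and \<tau>: "0 < \<tau>" and c: "0 < c" "c * \<tau> \<le> 1 / 16" and c\<^sub>1: "0 < c\<^sub>1"
    and geom: "\<And>u. u \<in> nonisotropic_ball \<nu> (c * \<tau>) \<Longrightarrow> z + u \<in> \<Omega> \<and>
      z + u - \<zeta> \<in> nonisotropic_ball \<nu> s \<and>
      c\<^sub>1 * \<tau> \<le> boundary_dist \<Omega> (z + u) \<and> boundary_dist \<Omega> (z + u) \<le> c\<^sub>2 * \<tau>"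
  shows "(cmod (f z))\<^sup>2 * (unit_ball_vol (real (2 * CARD('n))) / 4 * (c * \<tau>) * (c * \<tau> / 16) ^ CARD('n))
    \<le> max (c\<^sub>1 powr \<alpha>) (c\<^sub>2 powr \<alpha>) * \<tau> powr \<alpha> *
      measure (bergman_measure \<alpha> \<Omega> f) {w. w - \<zeta> \<in> nonisotropic_ball \<nu> s}"
    (is "?F * ?V \<le> ?C * measure ?\<mu> ?A")
proof -
  interpret \<mu>: finite_measure ?\<mu> by (rule finite_bergman_measure[OF f])
  note [measurable] = bergman_density_measurable[OF f]
  let ?B = "nonisotropic_ball \<nu> (c * \<tau>)"
  let ?\<phi> = "bergman_density \<alpha> \<Omega> f"
  have "?A = (\<lambda>w. w - \<zeta>) -` nonisotropic_ball \<nu> s" by auto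
  then have "open ?A" by (simp add: open_nonisotropic_ball open_vimage continuous_intros)
  then have [measurable]: "?A \<in> sets borel" by simp
  have V: "0 \<le> ?V"
    using c \<tau> by (intro mult_nonneg_nonneg divide_nonneg_nonneg unit_ball_vol_nonneg of_nat_0_le_iff zero_le_power) auto
  have C: "0 \<le> ?C" by (simp add: le_max_iff_disj)
  have pointwise: "ennreal ((cmod (f (z + u)))\<^sup>2) * indicator ?B u
      \<le> ennreal ?C * (ennreal (?\<phi> (z + u)) * indicator ?A (z + u))" for u
  proof (cases "u \<in> ?B")
    case True
    note G = geom[OF True]
    have b: "0 < boundary_dist \<Omega> (z + u)" using G mult_pos_pos[OF c\<^sub>1 \<tau>] by linarith
    have "(cmod (f (z + u)))\<^sup>2 = boundary_dist \<Omega> (z + u) powr \<alpha> * ?\<phi> (z + u)"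
      using G b by (simp add: bergman_density_def powr_minus)
    also have "\<dots> \<le> ?C * ?\<phi> (z + u)"
      using G by (intro mult_right_mono powr_between_le[OF c\<^sub>1 \<tau>] bergman_density_nonneg) auto
    finally have "ennreal ((cmod (f (z + u)))\<^sup>2) \<le> ennreal (?C * ?\<phi> (z + u))" by (rule ennreal_leI)
    then have "ennreal ((cmod (f (z + u)))\<^sup>2) \<le> ennreal ?C * ennreal (?\<phi> (z + u))"
      using C by (simp only: ennreal_mult[OF _ bergman_density_nonneg])
    moreover have "z + u \<in> ?A" using G by simp
    ultimately show ?thesis using True by (simp only: indicator_simps mult_1_right)
  next
    case False
    then have "ennreal ((cmod (f (z + u)))\<^sup>2) * indicator ?B u = 0" by simp
    then show ?thesis by (simp only: zero_le)
  qed
  have hol: "holomorphic_on_Cn f \<Omega>" using f by (simp add: weighted_bergman_space_def)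
  have "ennreal (?F * ?V) = ennreal ?F * ennreal ?V" by (rule ennreal_mult[OF zero_le_power2 V])
  also have "\<dots> \<le> ennreal ?F * emeasure lborel ?B"
    using c \<tau> by (intro mult_left_mono emeasure_nonisotropic_ball_ge \<nu>) auto
  also have "\<dots> \<le> (\<integral>\<^sup>+u\<in>?B. ennreal ((cmod (f (z + u)))\<^sup>2) \<partial>lborel)"
    using geom by (intro cmod_square_mean_balanced[OF hol \<Omega> open_nonisotropic_ball scalar_mult_in_nonisotropic_ball]) auto
  also have "\<dots> \<le> (\<integral>\<^sup>+u. ennreal ?C * (ennreal (?\<phi> (z + u)) * indicator ?A (z + u)) \<partial>lborel)"
    by (intro nn_integral_mono pointwise)
  also have "\<dots> = ennreal ?C * (\<integral>\<^sup>+u. ennreal (?\<phi> (z + u)) * indicator ?A (z + u) \<partial>lborel)"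
    by (rule nn_integral_cmult) measurable
  also have "(\<integral>\<^sup>+u. ennreal (?\<phi> (z + u)) * indicator ?A (z + u) \<partial>lborel)
      = (\<integral>\<^sup>+w. ennreal (?\<phi> w) * indicator ?A w \<partial>lborel)"
    by (rule nn_integral_lborel_translate[of "\<lambda>w. ennreal (?\<phi> w) * indicator ?A w"]) measurable
  also have "\<dots> = emeasure ?\<mu> ?A"
    unfolding bergman_measure_def by (subst emeasure_density) simp_all
  also have "\<dots> = ennreal (measure ?\<mu> ?A)" by (rule \<mu>.emeasure_eq_measure)
  also have "ennreal ?C * \<dots> = ennreal (?C * measure ?\<mu> ?A)"
    by (rule ennreal_mult[symmetric, OF C measure_nonneg])
  finally show ?thesis
    using C by (subst (asm) ennreal_le_iff) (auto intro: mult_nonneg_nonneg)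
qed

text \<open>Dividing the pointwise bound by a volume of order \<tau>^(n+1) bounds
  \<tau>^(1-\<alpha>) |f|^2 by a constant times the density at scale K \<tau>.\<close>

lemma tendsto_admissible_if_density_zero:
  fixes \<Omega> :: "(complex ^ 'n) set"
  assumes patch: "C2_patch \<Omega> \<zeta>\<^sub>0 \<rho> m M L r g" and f: "f \<in> weighted_bergman_space \<alpha> \<Omega>"
    and \<zeta>: "\<zeta> \<in> ball \<zeta>\<^sub>0 (\<rho> / 4)" "\<zeta> \<in> frontier \<Omega>" and t: "0 < t"
    and lim: "((\<lambda>s. measure (bergman_measure \<alpha> \<Omega> f)
        {w. w - \<zeta> \<in> nonisotropic_ball (unit_outward_normal \<Omega> \<zeta>) s} / s ^ CARD('n)) \<longlongrightarrow> 0) (at_right 0)"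
  shows "((\<lambda>z. tangential_dist \<Omega> \<zeta> z powr ((1 - \<alpha>) / 2) * cmod (f z)) \<longlongrightarrow> 0)
    (at \<zeta> within admissible_region \<Omega> \<zeta> t)"
proof -
  interpret C2_patch \<Omega> \<zeta>\<^sub>0 \<rho> m M L r g by fact
  let ?T = "tangential_dist \<Omega> \<zeta>" and ?R = "admissible_region \<Omega> \<zeta> t" and ?n = "CARD('n)"
  define D where "D = (\<lambda>s. measure (bergman_measure \<alpha> \<Omega> f) {w. w - \<zeta> \<in> nonisotropic_ball (\<nu> \<zeta>) s} / s ^ ?n)"
  obtain c K c\<^sub>1 c\<^sub>2 e where c: "0 < c" "c \<le> 1" and K: "0 < K" and c12: "0 < c\<^sub>1" "0 < c\<^sub>2" and e: "0 < e"
    and T: "\<And>z. z \<in> ?R \<Longrightarrow> 0 < ?T z" "\<And>z. z \<in> ?R \<Longrightarrow> ?T z \<le> norm (z - \<zeta>)"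
    and geom: "\<And>z u. z \<in> ?R \<Longrightarrow> norm (z - \<zeta>) < e \<Longrightarrow>
      u \<in> nonisotropic_ball (\<nu> \<zeta>) (c * ?T z) \<Longrightarrow>
      z + u \<in> \<Omega> \<and> z + u - \<zeta> \<in> nonisotropic_ball (\<nu> \<zeta>) (K * ?T z) \<and>
      c\<^sub>1 * ?T z \<le> boundary_dist \<Omega> (z + u) \<and> boundary_dist \<Omega> (z + u) \<le> c\<^sub>2 * ?T z"
    by (rule admissible_region_geometry[OF patch \<zeta> t]) blast
  have \<zeta>B: "\<zeta> \<in> ball \<zeta>\<^sub>0 \<rho>" using \<zeta>(1) pos by auto
  define v where "v = unit_ball_vol (real (2 * ?n)) / 4 * c * (c / 16) ^ ?n"
  have v: "0 < v"
    unfolding v_def using c by (intro mult_pos_pos divide_pos_pos zero_less_power unit_ball_vol_pos) auto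
  \<comment> \<open>The factor K^n compensates for dividing by (K \<tau>)^n in
    \<open>D\<close>.\<close>
  define C where "C = max (c\<^sub>1 powr \<alpha>) (c\<^sub>2 powr \<alpha>) * K ^ ?n / v"
  have est: "?T z powr ((1 - \<alpha>) / 2) * cmod (f z) \<le> sqrt (C * D (K * ?T z))"
    if z: "z \<in> ?R" "norm (z - \<zeta>) < min e (1 / 16)" for z
  proof -
    define \<tau> where "\<tau> = ?T z"
    have \<tau>: "0 < \<tau>" "\<tau> < 1 / 16" using T[OF z(1)] z(2) by (simp_all add: \<tau>_def)
    have "c * \<tau> \<le> 1 * \<tau>" using c \<tau> by (intro mult_right_mono) auto
    then have c\<tau>: "c * \<tau> \<le> 1 / 16" using \<tau> by linarith
    let ?mu = "measure (bergman_measure \<alpha> \<Omega> f) {w. w - \<zeta> \<in> nonisotropic_ball (\<nu> \<zeta>) (K * \<tau>)}"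
    have "(cmod (f z))\<^sup>2 * (unit_ball_vol (real (2 * ?n)) / 4 * (c * \<tau>) * (c * \<tau> / 16) ^ ?n)
        \<le> max (c\<^sub>1 powr \<alpha>) (c\<^sub>2 powr \<alpha>) * \<tau> powr \<alpha> * ?mu"
    proof (rule cmod_square_le_bergman_measure[OF open_\<Omega> f norm_normal(1)[OF \<zeta>B \<zeta>(2)] \<tau>(1) c(1) c\<tau> c12(1)])
      fix u assume "u \<in> nonisotropic_ball (\<nu> \<zeta>) (c * \<tau>)"
      then show "z + u \<in> \<Omega> \<and> z + u - \<zeta> \<in> nonisotropic_ball (\<nu> \<zeta>) (K * \<tau>) \<and>
          c\<^sub>1 * \<tau> \<le> boundary_dist \<Omega> (z + u) \<and> boundary_dist \<Omega> (z + u) \<le> c\<^sub>2 * \<tau>"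
        unfolding \<tau>_def using z by (intro geom) auto
    qed
    also have "unit_ball_vol (real (2 * ?n)) / 4 * (c * \<tau>) * (c * \<tau> / 16) ^ ?n = v * (\<tau> * \<tau> ^ ?n)"
      by (simp add: v_def power_mult_distrib power_divide)
    finally have "(cmod (f z))\<^sup>2 * (v * (\<tau> * \<tau> ^ ?n)) * \<tau> powr (- \<alpha>)
        \<le> max (c\<^sub>1 powr \<alpha>) (c\<^sub>2 powr \<alpha>) * \<tau> powr \<alpha> * ?mu * \<tau> powr (- \<alpha>)"
      by (rule mult_right_mono) simp
    also have "\<dots> = max (c\<^sub>1 powr \<alpha>) (c\<^sub>2 powr \<alpha>) * ?mu * (\<tau> powr \<alpha> * \<tau> powr (- \<alpha>))" by (simp only: mult_ac)
    also have "\<tau> powr \<alpha> * \<tau> powr (- \<alpha>) = 1" using \<tau> by (simp add: powr_minus)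
    finally have "(cmod (f z))\<^sup>2 * (\<tau> * \<tau> powr (- \<alpha>)) * (v * \<tau> ^ ?n) \<le> max (c\<^sub>1 powr \<alpha>) (c\<^sub>2 powr \<alpha>) * ?mu"
      by (simp only: mult_1_right mult_ac)
    moreover have "\<tau> * \<tau> powr (- \<alpha>) = \<tau> powr (1 - \<alpha>)"
      using \<tau> by (simp add: powr_diff powr_minus field_simps)
    ultimately have "(cmod (f z))\<^sup>2 * \<tau> powr (1 - \<alpha>) \<le> max (c\<^sub>1 powr \<alpha>) (c\<^sub>2 powr \<alpha>) * ?mu / (v * \<tau> ^ ?n)"
      using v \<tau> by (subst pos_le_divide_eq) auto
    also have "\<dots> = C * D (K * \<tau>)"
      using K \<tau> v by (simp add: C_def D_def power_mult_distrib)
    finally have 1: "(cmod (f z))\<^sup>2 * \<tau> powr (1 - \<alpha>) \<le> C * D (K * \<tau>)" .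
    have "(\<tau> powr ((1 - \<alpha>) / 2))\<^sup>2 = \<tau> powr (1 - \<alpha>)"
      using \<tau> by (simp add: power2_eq_square flip: powr_add)
    then have "(\<tau> powr ((1 - \<alpha>) / 2) * cmod (f z))\<^sup>2 \<le> C * D (K * \<tau>)"
      using 1 by (simp add: power_mult_distrib mult.commute)
    then show ?thesis unfolding \<tau>_def by (rule real_le_rsqrt)
  qed
  have ev: "\<forall>\<^sub>F z in at \<zeta> within ?R. z \<in> ?R \<and> norm (z - \<zeta>) < min e (1 / 16)"
    unfolding eventually_at using e by (intro exI[of _ "min e (1 / 16)"]) (auto simp: dist_norm)
  have norm0: "((\<lambda>z. K * norm (z - \<zeta>)) \<longlongrightarrow> 0) (at \<zeta> within ?R)"
    by (rule tendsto_eq_intros refl | simp)+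
  \<comment> \<open>On the region \<tau> is positive and at most |z - \<zeta>|, so K \<tau> tends to
    0 from the right and the density limit can be composed with it.\<close>
  have "((\<lambda>z. K * ?T z) \<longlongrightarrow> 0) (at \<zeta> within ?R)"
  proof (rule Lim_null_comparison[OF _ norm0])
    show "\<forall>\<^sub>F z in at \<zeta> within ?R. norm (K * ?T z) \<le> K * norm (z - \<zeta>)"
      using ev
    proof eventually_elim
      case (elim z)
      then have "0 < ?T z" "?T z \<le> norm (z - \<zeta>)" using T by blast+
      then show ?case using K by (simp add: abs_mult)
    qed
  qed
  moreover have "\<forall>\<^sub>F z in at \<zeta> within ?R. K * ?T z \<in> {0<..} \<and> K * ?T z \<noteq> 0"
    using ev by eventually_elim (use T(1) K in \<open>auto simp: less_imp_neq[symmetric]\<close>)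
  ultimately have "filterlim (\<lambda>z. K * ?T z) (at_right 0) (at \<zeta> within ?R)"
    unfolding filterlim_at by blast
  moreover have "(D \<longlongrightarrow> 0) (at_right 0)" using lim unfolding D_def .
  ultimately have "((\<lambda>z. D (K * ?T z)) \<longlongrightarrow> 0) (at \<zeta> within ?R)" by (rule filterlim_compose[rotated])
  then have "((\<lambda>z. sqrt (C * D (K * ?T z))) \<longlongrightarrow> sqrt (C * 0)) (at \<zeta> within ?R)"
    by (intro tendsto_intros)
  then have "((\<lambda>z. sqrt (C * D (K * ?T z))) \<longlongrightarrow> 0) (at \<zeta> within ?R)" by simp
  then show ?thesis
  proof (rule Lim_null_comparison[rotated])
    show "\<forall>\<^sub>F z in at \<zeta> within ?R. norm (?T z powr ((1 - \<alpha>) / 2) * cmod (f z)) \<le> sqrt (C * D (K * ?T z))"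
      using ev
    proof eventually_elim
      case (elim z)
      then show ?case using est[of z] by simp
    qed
  qed
qed

section \<open>From local null sets to the whole boundary by compactness\<close>

theorem theorem1p6:
  fixes \<Omega> :: "(complex ^ 'n) set" and \<alpha> :: real and f :: "complex ^ 'n \<Rightarrow> complex"
  assumes "open \<Omega>" and "connected \<Omega>" and "\<Omega> \<noteq> {}" and "bounded \<Omega>" and "C2_boundary \<Omega>"
    and "\<alpha> < 1"
    and "f \<in> weighted_bergman_space \<alpha> \<Omega>"
  shows "AE \<zeta> in surface_measure \<Omega>. \<forall>t>0.
    ((\<lambda>z. tangential_dist \<Omega> \<zeta> z powr ((1 - \<alpha>) / 2) * cmod (f z)) \<longlongrightarrow> 0)
      (at \<zeta> within admissible_region \<Omega> \<zeta> t)"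
proof -
  let ?H = "hausdorff_outer_measure (DIM(complex ^ 'n) - 1)"
  let ?lim = "\<lambda>\<zeta>. \<forall>t>0. ((\<lambda>z. tangential_dist \<Omega> \<zeta> z powr ((1 - \<alpha>) / 2) * cmod (f z)) \<longlongrightarrow> 0)
      (at \<zeta> within admissible_region \<Omega> \<zeta> t)"
  let ?bad = "\<lambda>\<zeta>\<^sub>0 \<rho>. {\<zeta> \<in> frontier \<Omega> \<inter> ball \<zeta>\<^sub>0 (\<rho> / 4). \<not> ?lim \<zeta>}"
  have "\<forall>\<zeta>\<^sub>0\<in>frontier \<Omega>. \<exists>\<rho>>0. ?H (?bad \<zeta>\<^sub>0 \<rho>) = 0"
  proof
    fix \<zeta>\<^sub>0 assume "\<zeta>\<^sub>0 \<in> frontier \<Omega>"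
    then obtain \<rho> m M L r g where patch: "C2_patch \<Omega> \<zeta>\<^sub>0 \<rho> m M L r g"
      by (rule exists_C2_patch[OF assms(1,5)])
    let ?N = "{\<zeta> \<in> frontier \<Omega> \<inter> ball \<zeta>\<^sub>0 (\<rho> / 4). \<not> ((\<lambda>s. measure (bergman_measure \<alpha> \<Omega> f)
        {w. w - \<zeta> \<in> nonisotropic_ball (unit_outward_normal \<Omega> \<zeta>) s} / s ^ CARD('n)) \<longlongrightarrow> 0) (at_right 0)}"
    have "hausdorff_outer_measure (2 * CARD('n) - 1) ?N = 0"
      by (rule nonisotropic_density_zero[OF patch finite_bergman_measure[OF assms(7)]
            sets_bergman_measure bergman_measure_frontier[OF assms(1,7)]])
    moreover have "DIM(complex ^ 'n) = 2 * CARD('n)" by simp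
    ultimately have "?H ?N = 0" by (simp only:)
    \<comment> \<open>The density condition does not involve \<open>t\<close>, so a single null set
      serves all apertures at once.\<close>
    moreover have "?bad \<zeta>\<^sub>0 \<rho> \<subseteq> ?N"
    proof
      fix \<zeta> assume \<zeta>: "\<zeta> \<in> ?bad \<zeta>\<^sub>0 \<rho>"
      then have "\<zeta> \<in> ball \<zeta>\<^sub>0 (\<rho> / 4)" "\<zeta> \<in> frontier \<Omega>" by simp_all
      note tendsto_admissible_if_density_zero[OF patch assms(7) this]
      then show "\<zeta> \<in> ?N" using \<zeta> unfolding mem_Collect_eq by blast
    qed
    then have "?H (?bad \<zeta>\<^sub>0 \<rho>) \<le> ?H ?N" by (rule hausdorff_outer_measure_mono)
    ultimately have "?H (?bad \<zeta>\<^sub>0 \<rho>) = 0" by (simp only: le_zero_eq)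
    then show "\<exists>\<rho>>0. ?H (?bad \<zeta>\<^sub>0 \<rho>) = 0" using C2_patch.pos(1)[OF patch] by blast
  qed
  from bchoice[OF this] obtain \<rho>
    where \<rho>: "\<forall>\<zeta>\<^sub>0\<in>frontier \<Omega>. 0 < \<rho> \<zeta>\<^sub>0 \<and> ?H (?bad \<zeta>\<^sub>0 (\<rho> \<zeta>\<^sub>0)) = 0" ..
  \<comment> \<open>Boundedness of \<Omega> enters here: finitely many of the balls cover the
    boundary, and finitely many null sets have a null union.\<close>
  have "compact (frontier \<Omega>)" using assms(4) by (rule compact_frontier_bounded)
  moreover have "frontier \<Omega> \<subseteq> (\<Union>\<zeta>\<^sub>0\<in>frontier \<Omega>. ball \<zeta>\<^sub>0 (\<rho> \<zeta>\<^sub>0 / 4))"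
  proof
    fix \<zeta> assume "\<zeta> \<in> frontier \<Omega>"
    moreover from bspec[OF \<rho> this] have "\<zeta> \<in> ball \<zeta> (\<rho> \<zeta> / 4)" by (elim conjE) simp
    ultimately show "\<zeta> \<in> (\<Union>\<zeta>\<^sub>0\<in>frontier \<Omega>. ball \<zeta>\<^sub>0 (\<rho> \<zeta>\<^sub>0 / 4))" by (rule UN_I)
  qed
  ultimately obtain F where F: "F \<subseteq> frontier \<Omega>" "finite F"
    "frontier \<Omega> \<subseteq> (\<Union>\<zeta>\<^sub>0\<in>F. ball \<zeta>\<^sub>0 (\<rho> \<zeta>\<^sub>0 / 4))"
    by (rule compactE_image[OF _ open_ball])
  have "?H (\<Union>\<zeta>\<^sub>0\<in>F. ?bad \<zeta>\<^sub>0 (\<rho> \<zeta>\<^sub>0)) = 0"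
  proof (rule hausdorff_outer_measure_UN_null)
    show "countable F" using F(2) by (rule countable_finite)
    show "?H (?bad \<zeta>\<^sub>0 (\<rho> \<zeta>\<^sub>0)) = 0" if "\<zeta>\<^sub>0 \<in> F" for \<zeta>\<^sub>0
      using bspec[OF \<rho> subsetD[OF F(1) that]] by (rule conjunct2)
  qed
  moreover have "{\<zeta> \<in> frontier \<Omega>. \<not> ?lim \<zeta>} \<subseteq> (\<Union>\<zeta>\<^sub>0\<in>F. ?bad \<zeta>\<^sub>0 (\<rho> \<zeta>\<^sub>0))"
    using F(3) by blast
  then have "?H {\<zeta> \<in> frontier \<Omega>. \<not> ?lim \<zeta>} \<le> ?H (\<Union>\<zeta>\<^sub>0\<in>F. ?bad \<zeta>\<^sub>0 (\<rho> \<zeta>\<^sub>0))"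
    by (rule hausdorff_outer_measure_mono)
  ultimately have "?H {\<zeta> \<in> frontier \<Omega>. \<not> ?lim \<zeta>} = 0" by (simp only: le_zero_eq)
  then show ?thesis unfolding AE_surface_measure_iff .
qed

end
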